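(* Let $G=(V,E,w)$ be a finite vertex-weighted graph with nonnegative rational vertex weights and maximum degree $\Delta$. For any $\varepsilon\in(0,0.1]$ and any integer $k\ge \frac{4(1+\varepsilon)^2}{\varepsilon^2}\left(\ln\frac{1}{\varepsilon}+4\right)\Delta$, there exists a $(1+3\varepsilon)$-EQ1 $k$-coloring of $G$. Additionally, such a coloring can be computed in polynomial time.
   Context: For $S\subseteq V$, $w(S)=\sum_{v\in S}w_v$. A $k$-coloring of $G$ is a partition $(C_1,\dots,C_k)$ of $V$ into $k$ (possibly empty) sets, each of which is an independent set of $G$. For $\alpha\ge 1$, a coloring $(C_1,\dots,C_k)$ is $\alpha$-EQ1 if for every $i,j\in[k]$ with $C_i\neq\emptyset$ there exists a vertex $\bar v\in C_i$ such that $w(C_i\setminus\{\bar v\})\le \alpha\, w(C_j)$. *)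

theory Defs
  imports Complex_Main
begin

definition weighted_graph :: "'v set \<Rightarrow> 'v set set \<Rightarrow> ('v \<Rightarrow> rat) \<Rightarrow> bool" where
  "weighted_graph V E w \<longleftrightarrow>
     finite V \<and>
     (\<forall>e\<in>E. \<exists>u\<in>V. \<exists>v\<in>V. u \<noteq> v \<and> e = {u, v}) \<and>
     (\<forall>v\<in>V. 0 \<le> w v)"

definition vdegree :: "'v set set \<Rightarrow> 'v \<Rightarrow> nat" where
  "vdegree E v = card {e \<in> E. v \<in> e}"

text \<open>The inserted 0 only matters for the graph without vertices.\<close>

definition max_degree :: "'v set \<Rightarrow> 'v set set \<Rightarrow> nat" where
  "max_degree V E = Max (insert 0 (vdegree E ` V))"

definition independent_set :: "'v set set \<Rightarrow> 'v set \<Rightarrow> bool" where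
  "independent_set E S \<longleftrightarrow> (\<forall>u\<in>S. \<forall>v\<in>S. {u, v} \<notin> E)"

definition is_coloring :: "'v set \<Rightarrow> 'v set set \<Rightarrow> nat \<Rightarrow> (nat \<Rightarrow> 'v set) \<Rightarrow> bool" where
  "is_coloring V E k C \<longleftrightarrow>
     (\<Union>i\<in>{1..k}. C i) = V \<and>
     (\<forall>i\<in>{1..k}. \<forall>j\<in>{1..k}. i \<noteq> j \<longrightarrow> C i \<inter> C j = {}) \<and>
     (\<forall>i\<in>{1..k}. independent_set E (C i))"

definition EQ1 :: "real \<Rightarrow> ('v \<Rightarrow> rat) \<Rightarrow> nat \<Rightarrow> (nat \<Rightarrow> 'v set) \<Rightarrow> bool" where
  "EQ1 \<alpha> w k C \<longleftrightarrow>
     (\<forall>i\<in>{1..k}. \<forall>j\<in>{1..k}. C i \<noteq> {} \<longrightarrow>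
        (\<exists>v\<in>C i. real_of_rat (sum w (C i - {v})) \<le> \<alpha> * real_of_rat (sum w (C j))))"


section \<open>Polynomial time\<close>

text \<open>
  The machine model is a first-order functional language with general recursion, evaluated call by
  value on binary trees. A program is a list of function bodies; variables are de Bruijn indices
  into the environment, and \<open>Case a b c\<close> evaluates \<open>c\<close> with the two subtrees of the value of \<open>a\<close>
  prepended to the environment. The last argument of \<open>computes\<close> is the number of rule applications.
  A rule application costs time bounded in terms of the program alone on a pointer machine
  (the only test is leaf versus node, and values are shared, not copied), so this time measure is
  polynomially related to that of Turing machines.
\<close>

datatype dat = Leaf | Node dat dat

datatype expr =
    Var nat
  | MkLeaf
  | MkNode expr expr
  | Case expr expr expr
  | Call nat "expr list"

inductive computes :: "expr list \<Rightarrow> dat list \<Rightarrow> expr \<Rightarrow> dat \<Rightarrow> nat \<Rightarrow> bool"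
  and computes_list :: "expr list \<Rightarrow> dat list \<Rightarrow> expr list \<Rightarrow> dat list \<Rightarrow> nat \<Rightarrow> bool"
  for P :: "expr list" where
  computes_Var: "i < length \<rho> \<Longrightarrow> computes P \<rho> (Var i) (\<rho> ! i) 1"
| computes_MkLeaf: "computes P \<rho> MkLeaf Leaf 1"
| computes_MkNode:
    "computes P \<rho> a x s \<Longrightarrow> computes P \<rho> b y t \<Longrightarrow>
     computes P \<rho> (MkNode a b) (Node x y) (s + t + 1)"
| computes_Case_Leaf:
    "computes P \<rho> a Leaf s \<Longrightarrow> computes P \<rho> b v t \<Longrightarrow>
     computes P \<rho> (Case a b c) v (s + t + 1)"
| computes_Case_Node:
    "computes P \<rho> a (Node x y) s \<Longrightarrow> computes P (x # y # \<rho>) c v t \<Longrightarrow>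
     computes P \<rho> (Case a b c) v (s + t + 1)"
| computes_Call:
    "f < length P \<Longrightarrow> computes_list P \<rho> as xs s \<Longrightarrow> computes P xs (P ! f) v t \<Longrightarrow>
     computes P \<rho> (Call f as) v (s + t + 1)"
| computes_Nil: "computes_list P \<rho> [] [] 1"
| computes_Cons:
    "computes P \<rho> a x s \<Longrightarrow> computes_list P \<rho> as xs t \<Longrightarrow>
     computes_list P \<rho> (a # as) (x # xs) (s + t + 1)"

inductive_cases computes_elims:
  "computes P \<rho> (Var i) v t"
  "computes P \<rho> MkLeaf v t"
  "computes P \<rho> (MkNode a b) v t"
  "computes P \<rho> (Case a b c) v t"
  "computes P \<rho> (Call f as) v t"
  "computes_list P \<rho> [] xs t"
  "computes_list P \<rho> (a # as) xs t"

lemma computes_deterministic: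
  "computes P \<rho> e v t \<Longrightarrow> computes P \<rho> e v' t' \<Longrightarrow> v = v' \<and> t = t'"
  "computes_list P \<rho> es vs t \<Longrightarrow> computes_list P \<rho> es vs' t' \<Longrightarrow> vs = vs' \<and> t = t'"
  apply (induction arbitrary: v' t' and vs' t' rule: computes_computes_list.inducts)
  subgoal by (erule computes_elims) simp
  subgoal by (erule computes_elims) simp
  subgoal by (erule computes_elims) (metis add.commute add_Suc Suc_eq_plus1)
  subgoal by (erule computes_elims) (metis Suc_eq_plus1, metis dat.distinct(1))
  subgoal by (erule computes_elims) (metis dat.distinct(1), metis Suc_eq_plus1 dat.inject)
  subgoal by (erule computes_elims) (metis Suc_eq_plus1)
  subgoal by (erule computes_elims) simp
  subgoal by (erule computes_elims) (metis Suc_eq_plus1)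
  done

definition runs :: "expr list \<Rightarrow> dat \<Rightarrow> dat \<Rightarrow> nat \<Rightarrow> bool" where
  "runs P x y t \<longleftrightarrow> computes P [x] (Call 0 [Var 0]) y t"

text \<open>
  A search problem is given by a set \<open>I\<close> of admissible inputs (a promise) and a relation \<open>R\<close> between
  inputs and acceptable outputs. Adding the size of the output to the running time accounts for
  writing it out as a tree without sharing.
\<close>

definition poly_time_solvable ::
  "('a \<Rightarrow> dat) \<Rightarrow> ('b \<Rightarrow> dat) \<Rightarrow> 'a set \<Rightarrow> ('a \<Rightarrow> 'b \<Rightarrow> bool) \<Rightarrow> bool" where
  "poly_time_solvable enc_in enc_out I R \<longleftrightarrow>
     (\<exists>P c. \<forall>x\<in>I. \<exists>y t. R x y \<and> runs P (enc_in x) (enc_out y) t \<and>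
        t + size (enc_out y) \<le> c * size (enc_in x) ^ c + c)"


section \<open>Inputs and outputs of the algorithm\<close>

text \<open>Numbers are in binary, least significant bit first.\<close>

fun enc_nat :: "nat \<Rightarrow> dat" where
  "enc_nat n = (if n = 0 then Leaf
     else Node (if even n then Leaf else Node Leaf Leaf) (enc_nat (n div 2)))"

declare enc_nat.simps [simp del]

definition enc_list :: "('a \<Rightarrow> dat) \<Rightarrow> 'a list \<Rightarrow> dat" where
  "enc_list enc xs = foldr (\<lambda>x d. Node (enc x) d) xs Leaf"

definition enc_pair :: "('a \<Rightarrow> dat) \<Rightarrow> ('b \<Rightarrow> dat) \<Rightarrow> 'a \<times> 'b \<Rightarrow> dat" where
  "enc_pair enc1 enc2 p = Node (enc1 (fst p)) (enc2 (snd p))"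

text \<open>Only used for nonnegative rationals; numerator and denominator are in lowest terms.\<close>

definition enc_rat :: "rat \<Rightarrow> dat" where
  "enc_rat q = enc_pair (\<lambda>a. enc_nat (nat a)) (\<lambda>b. enc_nat (nat b)) (quotient_of q)"

text \<open>
  An instance \<open>(ws, es, k)\<close> consists of the list of vertex weights, the list of edges and the number
  of colors; the vertices are the positions in \<open>ws\<close>.
\<close>

type_synonym inst = "rat list \<times> (nat \<times> nat) list \<times> nat"

definition enc_inst :: "inst \<Rightarrow> dat" where
  "enc_inst = enc_pair (enc_list enc_rat) (enc_pair (enc_list (enc_pair enc_nat enc_nat)) enc_nat)"

definition inst_V :: "inst \<Rightarrow> nat set" where
  "inst_V = (\<lambda>(ws, es, k). {..<length ws})"

definition inst_E :: "inst \<Rightarrow> nat set set" where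
  "inst_E = (\<lambda>(ws, es, k). {{u, v} |u v. (u, v) \<in> set es})"

definition inst_w :: "inst \<Rightarrow> nat \<Rightarrow> rat" where
  "inst_w = (\<lambda>(ws, es, k) v. ws ! v)"

definition inst_k :: "inst \<Rightarrow> nat" where
  "inst_k = (\<lambda>(ws, es, k). k)"

text \<open>\<open>k > 0\<close> excludes \<open>\<Delta> = k = 0\<close>, where no coloring exists unless the graph has no vertices.\<close>

definition admissible_inst :: "inst \<Rightarrow> real \<Rightarrow> bool" where
  "admissible_inst x \<epsilon> \<longleftrightarrow>
     weighted_graph (inst_V x) (inst_E x) (inst_w x) \<and> 0 < \<epsilon> \<and> \<epsilon> \<le> 1 / 10 \<and> 0 < inst_k x \<and>
     4 * (1 + \<epsilon>)\<^sup>2 / \<epsilon>\<^sup>2 * (ln (1 / \<epsilon>) + 4) * real (max_degree (inst_V x) (inst_E x)) \<le> real (inst_k x)"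

text \<open>The output lists the color of every vertex; \<open>classes\<close> turns it into a family of sets.\<close>

definition classes :: "nat list \<Rightarrow> nat \<Rightarrow> nat set" where
  "classes cs i = {v. v < length cs \<and> cs ! v = i}"

definition solves_inst :: "inst \<Rightarrow> real \<Rightarrow> nat list \<Rightarrow> bool" where
  "solves_inst x \<epsilon> cs \<longleftrightarrow>
     length cs = card (inst_V x) \<and>
     (\<forall>c\<in>set cs. c \<in> {1..inst_k x}) \<and>
     is_coloring (inst_V x) (inst_E x) (inst_k x) (classes cs) \<and>
     EQ1 (1 + 3 * \<epsilon>) (inst_w x) (inst_k x) (classes cs)"

end

theory Submission
  imports Defs
begin

text \<open>
  Process the vertices by decreasing weight and cut them into blocks in which all colors are
  different. A new vertex takes a color that is still unused in the current block, if need be after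
  one vertex of the block has moved to an unused color and made room; only the colors of
  neighbors in older blocks matter. If both attempts fail, then the
  vertex forbids every unused color, and at most \<open>\<Delta>\<close> colors in all, so that every unused color \<open>c\<close> is
  forbidden for at least \<open>k - \<Delta>\<close> vertices of the block; the block is closed and a new one is started.

  Hence, if a color \<open>c\<close> has been used \<open>s\<close> times and skipped in \<open>m\<close> closed blocks, counting
  the edges at its color class gives \<open>m (k - \<Delta>) \<le> s \<Delta>\<close>, that is, the number \<open>s + m\<close> of closed
  blocks is at most \<open>s k / (k - \<Delta>)\<close>. No color occurs twice in a block and weights decrease from
  block to block, so summation by parts over the blocks shows that the coloring is
  \<open>k / (k - \<Delta>)\<close>-EQ1, and \<open>k / (k - \<Delta>) \<le> 1 + 3 \<epsilon>\<close>. The algorithm does not depend on \<open>\<epsilon>\<close>.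

  For the running time, the functions computed by programs in polynomial time with outputs of
  polynomial size are shown to be closed under composition and under folding over a list when the
  intermediate states stay polynomially bounded.
\<close>

section \<open>The coloring algorithm\<close>

text \<open>Written with \<open>list_ex\<close> so that the closure rules for polynomial time apply
  to the definition as it stands.\<close>

definition free_for :: "('v \<Rightarrow> 'v \<Rightarrow> bool) \<Rightarrow> ('v \<times> 'c) list \<Rightarrow> 'v \<Rightarrow> 'c \<Rightarrow> bool" where
  "free_for adj F v c \<longleftrightarrow> \<not> list_ex (\<lambda>p. snd p = c \<and> adj (fst p) v) F"

definition unused :: "'c list \<Rightarrow> ('v \<times> 'c) list \<Rightarrow> 'c list" where
  "unused K B = filter (\<lambda>c. \<not> c \<in> set (map snd B)) K"

text \<open>A state consists of the current block and of the list of finished blocks, newest first.\<close>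

type_synonym ('v, 'c) state = "('v \<times> 'c) list \<times> ('v \<times> 'c) list list"

definition direct_colors ::
  "('v \<Rightarrow> 'v \<Rightarrow> bool) \<Rightarrow> 'c list \<Rightarrow> ('v, 'c) state \<Rightarrow> 'v \<Rightarrow> 'c list" where
  "direct_colors adj K s v =
     filter (\<lambda>c. free_for adj (concat (snd s)) v c) (unused K (fst s))"

text \<open>In \<open>(c, (u, d))\<close> the new vertex takes the color \<open>d\<close> of \<open>u\<close>, and \<open>u\<close> moves to \<open>c\<close>.\<close>

definition swaps ::
  "('v \<Rightarrow> 'v \<Rightarrow> bool) \<Rightarrow> 'c list \<Rightarrow> ('v, 'c) state \<Rightarrow> 'v \<Rightarrow> ('c \<times> 'v \<times> 'c) list" where
  "swaps adj K s v =
     filter (\<lambda>q. free_for adj (concat (snd s)) (fst (snd q)) (fst q) \<and>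
                 free_for adj (concat (snd s)) v (snd (snd q)))
       (List.product (unused K (fst s)) (fst s))"

text \<open>When a new block is opened, the block just closed counts as old, so the color must also
  be free against \<open>fst s\<close>. The final \<open>[]\<close> case makes the function total;
  with more than \<open>\<Delta>\<close> colors some color is always free there.\<close>

definition color_step ::
  "('v \<Rightarrow> 'v \<Rightarrow> bool) \<Rightarrow> 'c list \<Rightarrow> ('v, 'c) state \<Rightarrow> 'v \<Rightarrow> ('v, 'c) state" where
  "color_step adj K s v =
     (case direct_colors adj K s v of
        c # _ \<Rightarrow> ((v, c) # fst s, snd s)
      | [] \<Rightarrow>
        (case swaps adj K s v of
           q # _ \<Rightarrow>
             ((v, snd (snd q)) # (fst (snd q), fst q) # filter (\<lambda>p. \<not> p = snd q) (fst s), snd s)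
         | [] \<Rightarrow>
           (case filter (\<lambda>c. free_for adj (concat (fst s # snd s)) v c) K of
              c # _ \<Rightarrow> ([(v, c)], fst s # snd s)
            | [] \<Rightarrow> s)))"

definition color_vertices ::
  "('v \<Rightarrow> 'v \<Rightarrow> bool) \<Rightarrow> 'c list \<Rightarrow> 'v list \<Rightarrow> ('v, 'c) state" where
  "color_vertices adj K vs = foldl (color_step adj K) ([], []) vs"

definition color_class :: "('v \<times> 'c) list list \<Rightarrow> 'c \<Rightarrow> 'v set" where
  "color_class Bs c = {v. (v, c) \<in> set (concat Bs)}"

lemma color_class_simps [simp]:
  "color_class [] c = {}" "color_class (B # Bs) c = {v. (v, c) \<in> set B} \<union> color_class Bs c"
  by (auto simp: color_class_def)

lemma finite_color_class [simp]: "finite (color_class Bs c)"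
  by (rule finite_subset [of _ "fst ` set (concat Bs)"]) (force simp: color_class_def)+

lemma finite_block_class [simp]: "finite {v. (v, c) \<in> set B}"
  using finite_color_class [of "[B]" c] by simp

lemma free_for_iff: "free_for adj F v c \<longleftrightarrow> (\<forall>u. (u, c) \<in> set F \<longrightarrow> \<not> adj u v)"
  by (auto simp: free_for_def list_ex_iff)

lemma distinct_snd_unique:
  "distinct (map snd B) \<Longrightarrow> (u, c) \<in> set B \<Longrightarrow> (v, c) \<in> set B \<Longrightarrow> u = v"
  by (induction B) force+

lemma card_fst_filter:
  "distinct (map fst F) \<Longrightarrow> card (fst ` {p \<in> set F. Q p}) = card {p \<in> set F. Q p}"
  by (rule card_image) (auto simp: distinct_map intro: inj_on_subset)

lemma color_vertices_few:
  assumes "distinct K" "length vs \<le> length K"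
  obtains B where "color_vertices adj K vs = (B, [])" "map fst B = rev vs"
    "distinct (map snd B)" "snd ` set B \<subseteq> set K"
proof -
  have "\<exists>B. color_vertices adj K vs = (B, []) \<and> map fst B = rev vs \<and>
      distinct (map snd B) \<and> snd ` set B \<subseteq> set K"
    using assms(2)
  proof (induction vs rule: rev_induct)
    case Nil
    show ?case by (simp add: color_vertices_def)
  next
    case (snoc v vs)
    then obtain B where B: "color_vertices adj K vs = (B, [])" "map fst B = rev vs"
      "distinct (map snd B)" "snd ` set B \<subseteq> set K" by auto
    have "length B < length K"
      using snoc.prems arg_cong [OF B(2), of length] by simp
    then have "card (set (map snd B)) < card (set K)"
      using distinct_card [OF assms(1)] distinct_card [OF B(3)] by simp
    then have "\<not> set K \<subseteq> set (map snd B)"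
      using card_mono [of "set (map snd B)" "set K"] by auto
    then have "direct_colors adj K (B, []) v \<noteq> []"
      by (auto simp: direct_colors_def unused_def free_for_def filter_empty_conv)
    then obtain c cs where c: "direct_colors adj K (B, []) v = c # cs"
      by (cases "direct_colors adj K (B, []) v") auto
    then have "c \<in> set (direct_colors adj K (B, []) v)" by simp
    then have "c \<in> set K" "c \<notin> set (map snd B)"
      by (auto simp: direct_colors_def unused_def)
    moreover have "color_vertices adj K (vs @ [v]) = ((v, c) # B, [])"
      using B(1) c by (simp add: color_vertices_def color_step_def)
    ultimately show ?case using B by auto
  qed
  then show thesis using that by blast
qed


section \<open>Balance of the coloring\<close>

locale colored_graph =
  fixes V :: "'v set" and adj :: "'v \<Rightarrow> 'v \<Rightarrow> bool" and w :: "'v \<Rightarrow> real"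
    and \<Delta> :: nat and K :: "'c list"
  assumes finite_V: "finite V"
    and adj_sym: "adj u v \<Longrightarrow> adj v u"
    and adj_irrefl: "\<not> adj v v"
    and degree: "v \<in> V \<Longrightarrow> card {u \<in> V. adj u v} \<le> \<Delta>"
    and w_nonneg: "v \<in> V \<Longrightarrow> 0 \<le> w v"
    and distinct_K: "distinct K"
    and many_colors: "\<Delta> < length K"
begin

text \<open>Freedom is asked only against the older blocks \<open>Bs\<close>: inside the block,
  distinct colors already exclude conflicts. Weights are compared between blocks only, so a
  recoloring within the block does no harm.\<close>

definition block :: "('v \<times> 'c) list list \<Rightarrow> ('v \<times> 'c) list \<Rightarrow> bool" where
  "block Bs B \<longleftrightarrow> distinct (map snd B) \<and> snd ` set B \<subseteq> set K \<and>
     (\<forall>p\<in>set B. free_for adj (concat Bs) (fst p) (snd p)) \<and>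
     (\<forall>p\<in>set B. \<forall>q\<in>set (concat Bs). w (fst p) \<le> w (fst q))"

text \<open>Refers only to the class of \<open>c\<close> in the older blocks, so it stays true when
  newer blocks are put in front.\<close>

definition saturated :: "('v \<times> 'c) list list \<Rightarrow> ('v \<times> 'c) list \<Rightarrow> bool" where
  "saturated Bs B \<longleftrightarrow> (\<forall>c\<in>set K. c \<notin> snd ` set B \<longrightarrow>
     length K - \<Delta> \<le> card {v \<in> fst ` set B. \<exists>u\<in>color_class Bs c. adj u v})"

text \<open>The newest block comes first, so the tail consists of the blocks older than
  \<open>B\<close>. Nonemptiness gives every closed block a minimum weight.\<close>

fun chain :: "('v \<times> 'c) list list \<Rightarrow> bool" where
  "chain [] \<longleftrightarrow> True"
| "chain (B # Bs) \<longleftrightarrow> B \<noteq> [] \<and> block Bs B \<and> saturated Bs B \<and> chain Bs"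

definition invariant :: "'v list \<Rightarrow> ('v, 'c) state \<Rightarrow> bool" where
  "invariant vs s \<longleftrightarrow> distinct (map fst (concat (fst s # snd s))) \<and>
     fst ` set (concat (fst s # snd s)) = set vs \<and> block (snd s) (fst s) \<and> chain (snd s)"

section \<open>Forbidden colors and preservation of the invariant\<close>

lemma invariant_Pair:
  "invariant vs (B, Bs) \<longleftrightarrow> distinct (map fst (concat (B # Bs))) \<and>
     fst ` set (concat (B # Bs)) = set vs \<and> block Bs B \<and> chain Bs"
  by (simp only: invariant_def fst_conv snd_conv)

text \<open>A color is forbidden for \<open>v\<close> only by a neighbor that carries it, and every
  vertex occurs at most once in \<open>F\<close>; so forbidden colors are no more numerous than
  neighbors.\<close>

lemma card_forbidden:
  assumes "distinct (map fst F)" "fst ` set F \<subseteq> V" "v \<in> V"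
  shows "card {c. \<not> free_for adj F v c} \<le> \<Delta>" "finite {c. \<not> free_for adj F v c}"
proof -
  let ?N = "{p \<in> set F. adj (fst p) v}"
  have eq: "{c. \<not> free_for adj F v c} = snd ` ?N"
    by (force simp: free_for_iff)
  show "finite {c. \<not> free_for adj F v c}" unfolding eq by simp
  have "card (snd ` ?N) \<le> card ?N" by (rule card_image_le) simp
  also have "\<dots> = card (fst ` ?N)"
    using assms(1) by (rule card_fst_filter [symmetric])
  also have "\<dots> \<le> card {u \<in> V. adj u v}"
    using assms(2) finite_V by (intro card_mono) auto
  also have "\<dots> \<le> \<Delta>" by (rule degree [OF assms(3)])
  finally show "card {c. \<not> free_for adj F v c} \<le> \<Delta>" unfolding eq .
qed

lemma card_K: "card (set K) = length K"
  using distinct_K by (rule distinct_card)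

lemma ex_free_color:
  assumes "distinct (map fst F)" "fst ` set F \<subseteq> V" "v \<in> V"
  shows "\<exists>c\<in>set K. free_for adj F v c"
proof (rule ccontr)
  assume "\<not> ?thesis"
  then have "set K \<subseteq> {c. \<not> free_for adj F v c}" by auto
  then have "card (set K) \<le> card {c. \<not> free_for adj F v c}"
    using card_forbidden(2) [OF assms] by (rule card_mono [rotated])
  then show False
    using card_forbidden(1) [OF assms] many_colors card_K by simp
qed

lemma saturated_if_stuck:
  assumes inv: "invariant vs (B, Bs)" and vs: "set vs \<subseteq> V" "v \<in> V"
    and direct: "direct_colors adj K (B, Bs) v = []" and swaps: "swaps adj K (B, Bs) v = []"
  shows "saturated Bs B"
  unfolding saturated_def
proof (intro ballI impI)
  fix c assume c: "c \<in> set K" "c \<notin> snd ` set B"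
  let ?N = "{c. \<not> free_for adj (concat Bs) v c}"
  let ?S = "{v \<in> fst ` set B. \<exists>u\<in>color_class Bs c. adj u v}"
  have "fst ` set (concat Bs) \<subseteq> fst ` set (concat (B # Bs))" by (rule image_mono) auto
  then have F: "distinct (map fst (concat Bs))" "fst ` set (concat Bs) \<subseteq> V"
    using inv vs unfolding invariant_Pair by (simp, blast)
  have N: "card ?N \<le> \<Delta>" "finite ?N"
    using card_forbidden [OF F vs(2)] by simp_all
  have "set (unused K B) \<subseteq> ?N"
    using direct by (auto simp: direct_colors_def filter_empty_conv)
  then have 1: "set K - ?N \<subseteq> snd ` set B"
    by (auto simp: unused_def)
  have 2: "fst p \<in> ?S" if "p \<in> set B" "snd p \<notin> ?N" for p
  proof -
    have "(c, p) \<in> set (List.product (unused K B) B)"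
      using c that(1) by (auto simp: unused_def)
    then have "\<not> (free_for adj (concat Bs) (fst p) c \<and> free_for adj (concat Bs) v (snd p))"
      using swaps by (auto simp: swaps_def filter_empty_conv)
    then show ?thesis
      using that by (auto simp: free_for_iff color_class_def)
  qed
  let ?P = "{p \<in> set B. snd p \<notin> ?N}"
  have "length K - \<Delta> \<le> card (set K) - card ?N"
    using N card_K by simp
  also have "\<dots> \<le> card (set K - ?N)"
    using N(2) by (rule diff_card_le_card_Diff)
  also have "\<dots> \<le> card (snd ` ?P)"
    using 1 by (intro card_mono) auto
  also have "\<dots> \<le> card ?P" by (rule card_image_le) simp
  also have "\<dots> = card (fst ` ?P)"
    using inv by (intro card_fst_filter [symmetric]) (simp add: invariant_Pair)
  also have "\<dots> \<le> card ?S"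
    using 2 by (intro card_mono) auto
  finally show "length K - \<Delta> \<le> card ?S" .
qed

lemma invariant_step:
  assumes inv: "invariant vs s" and vs: "set vs \<subseteq> V" "v \<in> V" "v \<notin> set vs"
    and least: "\<And>u. u \<in> set vs \<Longrightarrow> w v \<le> w u"
  shows "invariant (vs @ [v]) (color_step adj K s v)"
proof -
  obtain B Bs where s: "s = (B, Bs)" by (cases s)
  have dist: "distinct (map fst (concat (B # Bs)))"
    and verts: "fst ` set (concat (B # Bs)) = set vs"
    and block: "block Bs B" and chain: "chain Bs"
    using inv unfolding invariant_Pair s by blast+
  have v_new: "v \<notin> fst ` set (concat (B # Bs))" using verts vs by simp
  have w_v: "w v \<le> w (fst q)" if "q \<in> set (concat (B # Bs))" for q
    using that verts by (intro least) force
  show ?thesis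
  proof (cases "direct_colors adj K (B, Bs) v")
    case (Cons c cs)
    then have "c \<in> set (direct_colors adj K (B, Bs) v)" by simp
    then have "c \<in> set K" "c \<notin> snd ` set B" "free_for adj (concat Bs) v c"
      by (auto simp: direct_colors_def unused_def)
    then have "block Bs ((v, c) # B)"
      using block w_v by (auto simp: block_def)
    moreover have "color_step adj K s v = ((v, c) # B, Bs)"
      using Cons by (simp add: color_step_def s)
    ultimately show ?thesis
      using dist verts v_new chain by (auto simp: invariant_def)
  next
    case direct: Nil
    show ?thesis
    proof (cases "swaps adj K (B, Bs) v")
      case (Cons q qs)
      obtain c u d where q: "q = (c, (u, d))" by (cases q) auto
      have "(c, (u, d)) \<in> set (swaps adj K (B, Bs) v)" using Cons q by simp
      then have c: "c \<in> set K" "c \<notin> snd ` set B" and ud: "(u, d) \<in> set B"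
        and free: "free_for adj (concat Bs) u c" "free_for adj (concat Bs) v d"
        by (auto simp: swaps_def unused_def)
      let ?R = "filter (\<lambda>p. \<not> p = (u, d)) B"
      have step: "color_step adj K s v = ((v, d) # (u, c) # ?R, Bs)"
        using direct Cons by (simp add: color_step_def s q)
      \<comment> \<open>Colors in the block are distinct, so removing the entry of \<open>u\<close>
        vacates \<open>d\<close>.\<close>
      have d_R: "d \<notin> snd ` set ?R"
        using distinct_snd_unique [OF _ _ ud] block by (auto simp: block_def)
      have inj: "inj_on fst (set B)" using dist by (simp add: distinct_map)
      have u_R: "u \<notin> fst ` set ?R"
        using inj_onD [OF inj _ ud] by auto
      have c_R: "c \<notin> snd ` set ?R" using c(2) by auto
      have cd: "c \<noteq> d" "d \<in> set K" using c(2) ud block by (auto simp: block_def image_iff)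
      have "distinct (map snd B)" "distinct (map fst B)"
        using block dist by (simp_all add: block_def)
      then have dist_R: "distinct (map snd ?R)" "distinct (map fst ?R)"
        by (simp_all only: distinct_map_filter)
      have R_free: "\<forall>p\<in>set ?R. free_for adj (concat Bs) (fst p) (snd p)"
        and R_K: "snd ` set ?R \<subseteq> set K"
        and R_w: "\<forall>p\<in>set ?R. \<forall>q\<in>set (concat Bs). w (fst p) \<le> w (fst q)"
        using block by (auto simp: block_def)
      have u_w: "\<forall>q\<in>set (concat Bs). w u \<le> w (fst q)"
        using block ud unfolding block_def by (metis fst_conv)
      have v_w: "\<forall>q\<in>set (concat Bs). w v \<le> w (fst q)"
        using w_v by auto
      have "block Bs ((v, d) # (u, c) # ?R)"
        unfolding block_def list.set(2) ball_simps fst_conv snd_conv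
        using dist_R(1) d_R c_R cd c(1) free R_free R_K R_w u_w v_w by simp
      moreover have fst_new: "fst ` set ((v, d) # (u, c) # ?R) = insert v (fst ` set B)"
      proof -
        have "set B = insert (u, d) (set ?R)" using ud by auto
        then have "fst ` set B = insert u (fst ` set ?R)"
          by (metis fst_conv image_insert)
        then show ?thesis by simp
      qed
      moreover have "distinct (map fst (concat (((v, d) # (u, c) # ?R) # Bs)))"
      proof -
        have "v \<noteq> u" "v \<notin> fst ` set ?R" using v_new ud by force+
        then have 1: "distinct (map fst ((v, d) # (u, c) # ?R))"
          using u_R dist_R(2) by simp
        have 2: "fst ` set ((v, d) # (u, c) # ?R) \<inter> fst ` set (concat Bs) = {}"
          unfolding fst_new using v_new dist by (auto simp: image_Un)
        show ?thesis using 1 2 dist by (simp only: concat.simps map_append distinct_append set_map)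
      qed
      moreover have "fst ` set (concat (((v, d) # (u, c) # ?R) # Bs)) = set (vs @ [v])"
      proof -
        have "fst ` set (concat (((v, d) # (u, c) # ?R) # Bs)) =
            fst ` set ((v, d) # (u, c) # ?R) \<union> fst ` set (concat Bs)"
          by (simp only: concat.simps set_append image_Un)
        also have "\<dots> = insert v (fst ` set (concat (B # Bs)))"
          unfolding fst_new by (simp add: image_Un)
        finally show ?thesis using verts by simp
      qed
      ultimately show ?thesis
        using chain unfolding invariant_Pair step by blast
    next
      case swaps: Nil
      have "B \<noteq> []"
      proof
        assume "B = []"
        then have "\<forall>c\<in>set K. \<not> free_for adj (concat Bs) v c"
          using direct by (auto simp: direct_colors_def unused_def filter_empty_conv)
        then show False
          using ex_free_color [of "concat Bs" v] dist verts vs by auto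
      qed
      \<comment> \<open>The new block has to respect \<open>B\<close> as well, since
        \<open>B\<close> is about to become an older block.\<close>
      obtain c cs where c: "filter (\<lambda>c. free_for adj (concat (B # Bs)) v c) K = c # cs"
        using ex_free_color [of "concat (B # Bs)" v] dist verts vs
        by (cases "filter (\<lambda>c. free_for adj (concat (B # Bs)) v c) K")
          (auto simp: filter_empty_conv)
      then have "c \<in> set (filter (\<lambda>c. free_for adj (concat (B # Bs)) v c) K)" by simp
      then have "block (B # Bs) [(v, c)]"
        using w_v by (auto simp: block_def)
      moreover have "color_step adj K s v = ([(v, c)], B # Bs)"
        using direct swaps c by (simp add: color_step_def s)
      moreover have "saturated Bs B"
        using saturated_if_stuck [OF inv [unfolded s] vs(1,2) direct swaps] .
      ultimately show ?thesis
        using dist verts v_new chain block \<open>B \<noteq> []\<close> by (auto simp: invariant_def)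
    qed
  qed
qed

lemma invariant_color_vertices:
  assumes "distinct vs" "set vs \<subseteq> V" "sorted_wrt (\<lambda>u v. w v \<le> w u) vs"
  shows "invariant vs (color_vertices adj K vs)"
  using assms
proof (induction vs rule: rev_induct)
  case Nil
  show ?case by (simp add: color_vertices_def invariant_def block_def)
next
  case (snoc v vs)
  then have "invariant vs (color_vertices adj K vs)" by (simp add: sorted_wrt_append)
  then show ?case
    using snoc.prems invariant_step [of vs "color_vertices adj K vs" v]
    by (simp add: color_vertices_def sorted_wrt_append)
qed

section \<open>Counting the closed blocks that skip a color\<close>

definition occurrences :: "'c \<Rightarrow> ('v \<times> 'c) list list \<Rightarrow> nat" where
  "occurrences c Bs = length (filter (\<lambda>B. c \<in> snd ` set B) Bs)"

text \<open>Double counting at the class of \<open>c\<close>: each block without \<open>c\<close>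
  contains at least \<open>length K - \<Delta>\<close> vertices with a neighbor in the class, and
  each of the at most \<open>occurrences c Bs\<close> class members has at most
  \<open>\<Delta>\<close> neighbors.\<close>

lemma chain_counting:
  assumes "chain Bs" "distinct (map fst (concat Bs))" "fst ` set (concat Bs) \<subseteq> V" "c \<in> set K"
  shows "length Bs * (length K - \<Delta>) \<le> occurrences c Bs * length K"
proof -
  let ?blocked = "\<lambda>Bs. {v \<in> fst ` set (concat Bs). \<exists>u\<in>color_class Bs c. adj u v}"
  have 1: "(length Bs - occurrences c Bs) * (length K - \<Delta>) \<le> card (?blocked Bs)"
    using assms(1,2)
  proof (induction Bs)
    case (Cons B Bs)
    let ?new = "{v \<in> fst ` set B. \<exists>u\<in>color_class Bs c. adj u v}"
    have IH: "(length Bs - occurrences c Bs) * (length K - \<Delta>) \<le> card (?blocked Bs)"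
      using Cons by simp
    have "occurrences c Bs \<le> length Bs" by (simp add: occurrences_def)
    \<comment> \<open>Blocked vertices stay blocked when the class grows. The new ones lie in
      \<open>B\<close>, whose vertices do not occur in older blocks, so the two counts add
      up.\<close>
    have "?blocked Bs \<union> ?new \<subseteq> ?blocked (B # Bs)" by auto
    then have "card (?blocked Bs \<union> ?new) \<le> card (?blocked (B # Bs))"
      by (intro card_mono) auto
    moreover have "card (?blocked Bs \<union> ?new) = card (?blocked Bs) + card ?new"
      using Cons.prems(2) by (intro card_Un_disjoint) auto
    ultimately have card: "card (?blocked Bs) + card ?new \<le> card (?blocked (B # Bs))" by simp
    show ?case
    proof (cases "c \<in> snd ` set B")
      case True
      then show ?thesis using IH card by (simp add: occurrences_def)
    next
      case False
      then have "length K - \<Delta> \<le> card ?new"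
        using Cons.prems(1) assms(4) by (simp add: saturated_def)
      moreover have "length (B # Bs) - occurrences c (B # Bs) = Suc (length Bs - occurrences c Bs)"
        using False \<open>occurrences c Bs \<le> length Bs\<close> by (simp add: occurrences_def Suc_diff_le)
      ultimately show ?thesis using IH card by simp
    qed
  qed simp
  \<comment> \<open>A block holds each color at most once, so a class is no larger than the number
    of blocks that contain its color.\<close>
  have "card (color_class Bs c) \<le> occurrences c Bs"
    using assms(1)
  proof (induction Bs)
    case (Cons B Bs)
    have le1: "card {v. (v, c) \<in> set B} \<le> (if c \<in> snd ` set B then 1 else 0)"
    proof (cases "c \<in> snd ` set B")
      case True
      then obtain v where v: "(v, c) \<in> set B" by auto
      have "distinct (map snd B)" using Cons.prems by (simp add: block_def)
      then have "{v. (v, c) \<in> set B} = {v}"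
        using v distinct_snd_unique by fastforce
      then show ?thesis using True by simp
    next
      case False
      then have "{v. (v, c) \<in> set B} = {}" by force
      then show ?thesis by simp
    qed
    have "card (color_class (B # Bs) c) \<le> card {v. (v, c) \<in> set B} + card (color_class Bs c)"
      by (simp add: card_Un_le)
    also have "\<dots> \<le> occurrences c (B # Bs)"
      using le1 Cons by (auto simp: occurrences_def split: if_splits)
    finally show ?case .
  qed (simp add: occurrences_def)
  moreover have "card (?blocked Bs) \<le> card (color_class Bs c) * \<Delta>"
  proof -
    have cls: "color_class Bs c \<subseteq> V" using assms(3) by (force simp: color_class_def)
    have "?blocked Bs \<subseteq> (\<Union>u\<in>color_class Bs c. {v \<in> V. adj v u})"
      using assms(3) adj_sym by blast
    then have "card (?blocked Bs) \<le> card (\<Union>u\<in>color_class Bs c. {v \<in> V. adj v u})"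
      using finite_V by (intro card_mono) auto
    also have "\<dots> \<le> (\<Sum>u\<in>color_class Bs c. card {v \<in> V. adj v u})"
      by (rule card_UN_le) simp
    also have "\<dots> \<le> (\<Sum>u\<in>color_class Bs c. \<Delta>)"
      using cls by (intro sum_mono degree) auto
    finally show ?thesis by simp
  qed
  ultimately have "card (?blocked Bs) \<le> occurrences c Bs * \<Delta>"
    using le_trans mult_right_mono by blast
  with 1 have 2: "(length Bs - occurrences c Bs) * (length K - \<Delta>) \<le> occurrences c Bs * \<Delta>"
    by simp
  have "length Bs = (length Bs - occurrences c Bs) + occurrences c Bs"
    by (simp add: occurrences_def)
  then have "length Bs * (length K - \<Delta>) =
      (length Bs - occurrences c Bs) * (length K - \<Delta>) + occurrences c Bs * (length K - \<Delta>)"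
    by (metis add_mult_distrib)
  also have "\<dots> \<le> occurrences c Bs * \<Delta> + occurrences c Bs * (length K - \<Delta>)"
    using 2 by simp
  \<comment> \<open>The subtraction is truncated; \<open>\<Delta> < length K\<close> lets
    \<open>\<Delta>\<close> and \<open>length K - \<Delta>\<close> add up to
    \<open>length K\<close>.\<close>
  also have "\<dots> = occurrences c Bs * length K"
    using many_colors by (simp flip: add_mult_distrib2)
  finally show ?thesis .
qed

section \<open>Comparing class weights through minimum weights of blocks\<close>

definition min_weight :: "('v \<times> 'c) list \<Rightarrow> real" where
  "min_weight B = Min (w ` fst ` set B)"

lemma min_weight_le: "p \<in> set B \<Longrightarrow> min_weight B \<le> w (fst p)"
  unfolding min_weight_def by (intro Min_le) auto

lemma le_min_weight: "B \<noteq> [] \<Longrightarrow> (\<And>p. p \<in> set B \<Longrightarrow> x \<le> w (fst p)) \<Longrightarrow> x \<le> min_weight B"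
  unfolding min_weight_def by (subst Min_ge_iff) auto

text \<open>Summation by parts over the blocks: the threshold \<open>\<tau>\<close> makes the induction go through.\<close>

lemma chain_lower_bound:
  fixes \<alpha> \<tau> :: real
  assumes chain: "chain Bs" "distinct (map fst (concat Bs))" "fst ` set (concat Bs) \<subseteq> V"
    and j: "j \<in> set K" and \<alpha>: "0 \<le> \<alpha>" "real (length K) \<le> \<alpha> * real (length K - \<Delta>)"
    and \<tau>: "0 \<le> \<tau>" "\<And>p. p \<in> set (concat Bs) \<Longrightarrow> \<tau> \<le> w (fst p)"
  shows "sum_list (map min_weight Bs) - \<alpha> * sum w (color_class Bs j) \<le>
    \<tau> * (length Bs - \<alpha> * occurrences j Bs)"
  using chain \<tau>
proof (induction Bs arbitrary: \<tau>)
  case Nil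
  show ?case by (simp add: occurrences_def)
next
  case (Cons B Bs)
  let ?m = "min_weight B"
  have wf: "B \<noteq> []" "block Bs B" "chain Bs" using Cons.prems(1) by simp_all
  have V: "fst p \<in> V" if "p \<in> set (concat (B # Bs))" for p using Cons.prems(3) that by auto
  have m_nonneg: "0 \<le> ?m"
    using wf(1) V by (intro le_min_weight w_nonneg) auto
  have m_le: "?m \<le> w (fst q)" if "q \<in> set (concat Bs)" for q
  proof -
    obtain p where "p \<in> set B" using wf(1) by (cases B) auto
    then have "w (fst p) \<le> w (fst q)" using wf(2) that by (auto simp: block_def)
    then show ?thesis using min_weight_le [OF \<open>p \<in> set B\<close>] by simp
  qed
  \<comment> \<open>The minimum weight of \<open>B\<close> is a valid threshold for the older
    blocks, all of whose vertices weigh at least as much.\<close>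
  have IH: "sum_list (map min_weight Bs) - \<alpha> * sum w (color_class Bs j) \<le>
      ?m * (length Bs - \<alpha> * occurrences j Bs)"
    using Cons.prems m_le by (intro Cons.IH m_nonneg wf) auto
  let ?o = "of_bool (j \<in> snd ` set B) :: real"
  have "?m * ?o \<le> sum w {v. (v, j) \<in> set B}"
  proof (cases "j \<in> snd ` set B")
    case True
    then obtain v where v: "(v, j) \<in> set B" by auto
    have "?m \<le> w v" using min_weight_le [OF v] by simp
    also have "\<dots> \<le> sum w {v. (v, j) \<in> set B}"
      using v V by (intro member_le_sum [OF _ _ finite_block_class] w_nonneg) force+
    finally show ?thesis using True by simp
  next
    case False
    then have "{v. (v, j) \<in> set B} = {}" by force
    then show ?thesis using False by simp
  qed
  then have B: "\<alpha> * (?m * ?o) \<le> \<alpha> * sum w {v. (v, j) \<in> set B}"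
    using \<alpha>(1) by (rule mult_left_mono)
  have "sum w (color_class (B # Bs) j) = sum w {v. (v, j) \<in> set B} + sum w (color_class Bs j)"
    unfolding color_class_simps
  proof (rule sum.union_disjoint)
    show "{v. (v, j) \<in> set B} \<inter> color_class Bs j = {}"
      using Cons.prems(2) by (force simp: color_class_def)
  qed simp_all
  moreover have occ: "real (occurrences j (B # Bs)) = ?o + occurrences j Bs"
    by (simp add: occurrences_def)
  ultimately have "sum_list (map min_weight (B # Bs)) - \<alpha> * sum w (color_class (B # Bs) j) \<le>
      ?m * (length (B # Bs) - \<alpha> * occurrences j (B # Bs))"
    using IH B by (simp add: algebra_simps)
  \<comment> \<open>By the block count the second factor is not positive, so lowering the first
    factor from \<open>?m\<close> to \<open>\<tau>\<close> can only increase the product.\<close>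
  also have "\<dots> \<le> \<tau> * (length (B # Bs) - \<alpha> * occurrences j (B # Bs))"
  proof (rule mult_right_mono_neg)
    show "\<tau> \<le> ?m" using wf(1) Cons.prems(5) by (intro le_min_weight) auto
    let ?k = "length K - \<Delta>"
    have "real (length (B # Bs)) * ?k \<le> occurrences j (B # Bs) * real (length K)"
      using chain_counting [OF Cons.prems(1-3) j] by (metis of_nat_le_iff of_nat_mult)
    also have "\<dots> \<le> occurrences j (B # Bs) * (\<alpha> * ?k)"
      using \<alpha>(2) by (rule mult_left_mono) simp
    finally have "real (length (B # Bs)) * ?k \<le> \<alpha> * occurrences j (B # Bs) * ?k"
      by (simp add: algebra_simps)
    then have "real (length (B # Bs)) \<le> \<alpha> * occurrences j (B # Bs)"
      by (rule mult_right_le_imp_le) (use many_colors in simp)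
    then show "length (B # Bs) - \<alpha> * occurrences j (B # Bs) \<le> 0" by simp
  qed
  finally show ?case .
qed

text \<open>The vertex of color \<open>i\<close> in the oldest block that has one is dropped. Every
  other vertex of the class is charged to the block just older than its own: it weighs at most the
  minimum there, and no block is charged twice.\<close>

lemma color_class_upper_bound:
  assumes "chain Bs" "block Bs B" "distinct (map fst (concat (B # Bs)))"
    "fst ` set (concat (B # Bs)) \<subseteq> V" "color_class (B # Bs) i \<noteq> {}"
  shows "\<exists>v\<in>color_class (B # Bs) i. sum w (color_class (B # Bs) i - {v}) \<le> sum_list (map min_weight Bs)"
  using assms
proof (induction Bs arbitrary: B)
  case Nil
  then obtain v where v: "(v, i) \<in> set B" by auto
  have "{v. (v, i) \<in> set B} = {v}"
    using v Nil.prems(2) distinct_snd_unique by (fastforce simp: block_def)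
  then show ?case by simp
next
  case (Cons B' Bs)
  let ?X = "color_class (B' # Bs) i" and ?A = "{v. (v, i) \<in> set B}"
  have V: "fst p \<in> V" if "p \<in> set (concat (B # B' # Bs))" for p using Cons.prems(4) that by blast
  have nonneg: "0 \<le> min_weight C" if "C \<in> set (B' # Bs)" "C \<noteq> []" for C
    using that V by (intro le_min_weight w_nonneg) auto
  have nonempty: "C \<noteq> []" if "C \<in> set Bs" for C
  proof -
    have "chain Bs" using Cons.prems(1) by simp
    then show ?thesis using that by (induction Bs) auto
  qed
  have A: "?A = {} \<or> (\<exists>v. ?A = {v})"
    using Cons.prems(2) distinct_snd_unique [of B] by (fastforce simp: block_def)
  have finA: "finite ?A" using A by auto
  show ?case
  proof (cases "?X = {}")
    case True
    then obtain v where v: "?A = {v}" using A Cons.prems(5) by auto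
    then have "color_class (B # B' # Bs) i = {v}" using True by simp
    moreover have "0 \<le> sum_list (map min_weight (B' # Bs))"
      using nonneg nonempty Cons.prems(1) by (intro sum_list_nonneg) auto
    ultimately show ?thesis by simp
  next
    case False
    have "\<exists>v\<in>?X. sum w (?X - {v}) \<le> sum_list (map min_weight Bs)"
      using Cons.prems False by (intro Cons.IH) auto
    then obtain v where v: "v \<in> ?X" "sum w (?X - {v}) \<le> sum_list (map min_weight Bs)" by blast
    have wV: "0 \<le> w x" if "x \<in> ?A \<union> ?X" for x
      using that V by (intro w_nonneg) (force simp: color_class_def)
    have "sum w ?A \<le> min_weight B'"
    proof (cases "?A = {}")
      case True
      then show ?thesis using nonneg Cons.prems(1) by simp
    next
      case False
      then obtain x where x: "?A = {x}" using A by auto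
      then have "(x, i) \<in> set B" by auto
      then have "w x \<le> w (fst q)" if "q \<in> set B'" for q
        using Cons.prems(2) that by (fastforce simp: block_def)
      then have "w x \<le> min_weight B'"
        using Cons.prems(1) by (intro le_min_weight) simp_all
      then show ?thesis using x by simp
    qed
    have "sum w (color_class (B # B' # Bs) i - {v}) \<le> sum w (?A \<union> (?X - {v}))"
      using wV finA by (intro sum_mono2) auto
    also have "\<dots> \<le> sum w ?A + sum w (?X - {v})"
      using wV finA sum_nonneg [of "?A \<inter> (?X - {v})" w] by (subst sum_Un) auto
    also have "\<dots> \<le> sum_list (map min_weight (B' # Bs))"
      using v(2) \<open>sum w ?A \<le> min_weight B'\<close> by simp
    finally show ?thesis using v(1) by auto
  qed
qed

theorem color_vertices_correct:
  fixes \<alpha> :: real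
  assumes vs: "distinct vs" "set vs \<subseteq> V" "sorted_wrt (\<lambda>u v. w v \<le> w u) vs"
    and \<alpha>: "0 \<le> \<alpha>" "real (length K) \<le> \<alpha> * real (length K - \<Delta>)"
    and s: "color_vertices adj K vs = (B, Bs)"
  shows "distinct (map fst (concat (B # Bs)))"
    and "fst ` set (concat (B # Bs)) = set vs"
    and "snd ` set (concat (B # Bs)) \<subseteq> set K"
    and "u \<in> color_class (B # Bs) c \<Longrightarrow> v \<in> color_class (B # Bs) c \<Longrightarrow> \<not> adj u v"
    and "color_class (B # Bs) i \<noteq> {} \<Longrightarrow> j \<in> set K \<Longrightarrow>
      \<exists>v\<in>color_class (B # Bs) i. sum w (color_class (B # Bs) i - {v}) \<le> \<alpha> * sum w (color_class (B # Bs) j)"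
proof -
  have inv: "invariant vs (B, Bs)"
    using invariant_color_vertices [OF vs] s by simp
  then show dist: "distinct (map fst (concat (B # Bs)))" and verts: "fst ` set (concat (B # Bs)) = set vs"
    unfolding invariant_Pair by blast+
  have block: "block Bs B" and chain: "chain Bs" using inv unfolding invariant_Pair by blast+
  have "snd ` set (concat Bs) \<subseteq> set K"
    using chain by (induction Bs) (auto simp: block_def)
  then show "snd ` set (concat (B # Bs)) \<subseteq> set K"
    using block by (auto simp: block_def)
  \<comment> \<open>Two vertices of one color in the same block coincide; in different blocks, the
    newer entry was free against the older one.\<close>
  have proper: "\<not> adj u v" if "block Bs B" "\<forall>u\<in>color_class Bs c. \<forall>v\<in>color_class Bs c. \<not> adj u v"
    "u \<in> color_class (B # Bs) c" "v \<in> color_class (B # Bs) c" for B Bs u v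
  proof -
    have free: "\<not> adj x y" if "(y, c) \<in> set B" "x \<in> color_class Bs c" for x y
      using that \<open>block Bs B\<close> by (force simp: block_def free_for_iff color_class_def)
    have same: "x = y" if "(x, c) \<in> set B" "(y, c) \<in> set B" for x y
      using distinct_snd_unique [OF _ that] \<open>block Bs B\<close> by (simp add: block_def)
    show ?thesis
      using that(2-4) free same adj_sym adj_irrefl unfolding color_class_simps by blast
  qed
  have "\<forall>u\<in>color_class Bs c. \<forall>v\<in>color_class Bs c. \<not> adj u v"
    using chain
  proof (induction Bs)
    case (Cons B Bs)
    then show ?case using proper [of Bs B] by (metis chain.simps(2))
  qed simp
  then show "u \<in> color_class (B # Bs) c \<Longrightarrow> v \<in> color_class (B # Bs) c \<Longrightarrow> \<not> adj u v"
    using proper block by blast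
  assume i: "color_class (B # Bs) i \<noteq> {}" and j: "j \<in> set K"
  have V: "fst ` set (concat (B # Bs)) \<subseteq> V" using verts vs(2) by simp
  obtain v where v: "v \<in> color_class (B # Bs) i"
    "sum w (color_class (B # Bs) i - {v}) \<le> sum_list (map min_weight Bs)"
    using color_class_upper_bound [OF chain block dist V i] by blast
  \<comment> \<open>The threshold 0 is allowed as weights are nonnegative, and it makes the
    right-hand side vanish.\<close>
  have "sum_list (map min_weight Bs) - \<alpha> * sum w (color_class Bs j) \<le> 0 * (length Bs - \<alpha> * occurrences j Bs)"
    using dist V w_nonneg by (intro chain_lower_bound chain j \<alpha>) auto
  moreover have "sum w (color_class Bs j) \<le> sum w (color_class (B # Bs) j)"
  proof (rule sum_mono2)
    show "0 \<le> w x" if "x \<in> color_class (B # Bs) j - color_class Bs j" for x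
      using that V by (intro w_nonneg) (force simp: color_class_def)
  qed auto
  then have "\<alpha> * sum w (color_class Bs j) \<le> \<alpha> * sum w (color_class (B # Bs) j)"
    using \<alpha>(1) by (rule mult_left_mono)
  ultimately show "\<exists>v\<in>color_class (B # Bs) i.
      sum w (color_class (B # Bs) i - {v}) \<le> \<alpha> * sum w (color_class (B # Bs) j)"
    using v by (intro bexI [of _ v]) auto
qed

end


section \<open>Polynomially bounded functions\<close>

text \<open>Running times are sums with \<open>+ 1\<close> and \<open>+ 2\<close>; they must not become \<open>Suc\<close> terms.\<close>

declare One_nat_def [simp del] add_2_eq_Suc [simp del] add_2_eq_Suc' [simp del]

text \<open>With base \<open>n + 2\<close>, which is at least 2 even for \<open>n = 0\<close>,
  powers dominate constants and one extra factor absorbs a sum, so a single exponent is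
  enough.\<close>

definition poly_bounded :: "(nat \<Rightarrow> nat) \<Rightarrow> bool" where
  "poly_bounded p \<longleftrightarrow> (\<exists>c. \<forall>n. p n \<le> (n + 2) ^ c)"

lemma poly_boundedE:
  assumes "poly_bounded p"
  obtains c where "\<And>n. p n \<le> (n + 2) ^ c"
  using assms unfolding poly_bounded_def by blast

lemma poly_bounded_const: "poly_bounded (\<lambda>_. a)"
proof -
  have "a \<le> (n + 2) ^ a" for n :: nat
  proof -
    have "a \<le> 2 ^ a" by (simp add: less_imp_le)
    also have "\<dots> \<le> (n + 2) ^ a" by (rule power_mono) auto
    finally show ?thesis .
  qed
  then show ?thesis unfolding poly_bounded_def by blast
qed

lemma poly_bounded_id: "poly_bounded (\<lambda>n. n)"
  unfolding poly_bounded_def by (rule exI [of _ 1]) auto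

lemma poly_bounded_mult:
  assumes "poly_bounded p" "poly_bounded q"
  shows "poly_bounded (\<lambda>n. p n * q n)"
proof -
  obtain c d where "\<And>n. p n \<le> (n + 2) ^ c" "\<And>n. q n \<le> (n + 2) ^ d"
    using assms by (meson poly_boundedE)
  then have "p n * q n \<le> (n + 2) ^ (c + d)" for n
    by (simp only: power_add) (rule mult_mono, auto)
  then show ?thesis unfolding poly_bounded_def by blast
qed

lemma poly_bounded_add:
  assumes "poly_bounded p" "poly_bounded q"
  shows "poly_bounded (\<lambda>n. p n + q n)"
proof -
  obtain c d where cd: "\<And>n. p n \<le> (n + 2) ^ c" "\<And>n. q n \<le> (n + 2) ^ d"
    using assms by (meson poly_boundedE)
  have "p n + q n \<le> (n + 2) ^ (c + d + 1)" for n
  proof -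
    have "p n + q n \<le> (n + 2) ^ (c + d) + (n + 2) ^ (c + d)"
      using le_trans [OF cd(1) power_increasing [of c "c + d" "n + 2"]]
        le_trans [OF cd(2) power_increasing [of d "c + d" "n + 2"]] by (intro add_mono) auto
    also have "\<dots> \<le> (n + 2) ^ (c + d + 1)"
      unfolding power_add [of _ "c + d" 1] power_one_right by (simp add: algebra_simps)
    finally show ?thesis .
  qed
  then show ?thesis unfolding poly_bounded_def by blast
qed

lemma poly_bounded_power: "poly_bounded p \<Longrightarrow> poly_bounded (\<lambda>n. p n ^ c)"
  by (induction c) (auto intro: poly_bounded_mult poly_bounded_const)

lemma poly_bounded_Suc: "poly_bounded p \<Longrightarrow> poly_bounded (\<lambda>n. Suc (p n))"
  using poly_bounded_add [OF _ poly_bounded_const [of 1], of p] by (simp add: One_nat_def)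

lemmas poly_bounded_intros =
  poly_bounded_const poly_bounded_id poly_bounded_Suc poly_bounded_add poly_bounded_mult
  poly_bounded_power

lemma poly_bounded_monomial:
  assumes "poly_bounded p"
  shows "\<exists>c. \<forall>n. p n \<le> c * n ^ c + c"
proof -
  obtain d where d: "\<And>n. p n \<le> (n + 2) ^ d" using assms by (meson poly_boundedE)
  \<comment> \<open>For positive \<open>n\<close> one has \<open>n + 2 \<le> 3 * n\<close>; for
    \<open>n = 0\<close> the additive term is large enough. The number \<open>3 ^ d + d\<close>
    serves as coefficient, exponent and summand at once.\<close>
  have "(n + 2) ^ d \<le> (3 ^ d + d) * n ^ (3 ^ d + d) + (3 ^ d + d)" for n :: nat
  proof (cases "n = 0")
    case True
    have "(2::nat) ^ d \<le> 3 ^ d" by (rule power_mono) auto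
    then show ?thesis using True by simp
  next
    case False
    have "(n + 2) ^ d \<le> (3 * n) ^ d" using False by (intro power_mono) auto
    also have "\<dots> = 3 ^ d * n ^ d" by (simp add: power_mult_distrib)
    also have "\<dots> \<le> (3 ^ d + d) * n ^ (3 ^ d + d)"
      using False by (intro mult_mono power_increasing) auto
    finally show ?thesis by simp
  qed
  then have "p n \<le> (3 ^ d + d) * n ^ (3 ^ d + d) + (3 ^ d + d)" for n
    using d le_trans by blast
  then show ?thesis by blast
qed


section \<open>Linking programs\<close>

text \<open>Relocation: functions are called by their position in the program, so code placed behind
  \<open>d\<close> other functions needs its call indices raised by \<open>d\<close>.\<close>

fun shift_calls :: "nat \<Rightarrow> expr \<Rightarrow> expr" where
  "shift_calls d (Var i) = Var i"
| "shift_calls d MkLeaf = MkLeaf"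
| "shift_calls d (MkNode a b) = MkNode (shift_calls d a) (shift_calls d b)"
| "shift_calls d (Case a b c) = Case (shift_calls d a) (shift_calls d b) (shift_calls d c)"
| "shift_calls d (Call f as) = Call (d + f) (map (shift_calls d) as)"

lemma shift_calls_0 [simp]: "shift_calls 0 e = e"
  by (induction "0::nat" e rule: shift_calls.induct) (auto simp: map_idI)

text \<open>Relocated code only calls relocated code, so results and exact times carry over
  unchanged.\<close>

lemma computes_link:
  "computes P \<rho> e v t \<Longrightarrow>
     computes (A @ map (shift_calls (length A)) P @ B) \<rho> (shift_calls (length A) e) v t"
  "computes_list P \<rho> es vs t \<Longrightarrow>
     computes_list (A @ map (shift_calls (length A)) P @ B) \<rho> (map (shift_calls (length A)) es) vs t"
  by (induction rule: computes_computes_list.inducts)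
    (auto simp: nth_append intro: computes_computes_list.intros)

text \<open>Upper bounds replace exact times, so that times need only be estimated.\<close>

definition run :: "expr list \<Rightarrow> dat list \<Rightarrow> expr \<Rightarrow> dat \<Rightarrow> nat \<Rightarrow> bool" where
  "run P \<rho> e v T \<longleftrightarrow> (\<exists>t\<le>T. computes P \<rho> e v t)"

definition run_list :: "expr list \<Rightarrow> dat list \<Rightarrow> expr list \<Rightarrow> dat list \<Rightarrow> nat \<Rightarrow> bool" where
  "run_list P \<rho> es vs T \<longleftrightarrow> (\<exists>t\<le>T. computes_list P \<rho> es vs t)"

lemma run_mono: "run P \<rho> e v T \<Longrightarrow> T \<le> T' \<Longrightarrow> run P \<rho> e v T'"
  unfolding run_def using le_trans by blast

lemma run_Var: "i < length \<rho> \<Longrightarrow> v = \<rho> ! i \<Longrightarrow> run P \<rho> (Var i) v 1"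
  unfolding run_def using computes_Var by blast

lemma run_MkLeaf: "run P \<rho> MkLeaf Leaf 1"
  unfolding run_def using computes_MkLeaf by blast

lemma run_MkNode: "run P \<rho> a x s \<Longrightarrow> run P \<rho> b y t \<Longrightarrow> run P \<rho> (MkNode a b) (Node x y) (s + t + 1)"
  unfolding run_def by (blast intro: computes_MkNode add_mono)

lemma run_Case_Leaf:
  "run P \<rho> a Leaf s \<Longrightarrow> run P \<rho> b v t \<Longrightarrow> run P \<rho> (Case a b c) v (s + t + 1)"
  unfolding run_def by (blast intro: computes_Case_Leaf add_mono)

lemma run_Case_Node:
  "run P \<rho> a (Node x y) s \<Longrightarrow> run P (x # y # \<rho>) c v t \<Longrightarrow> run P \<rho> (Case a b c) v (s + t + 1)"
  unfolding run_def by (blast intro: computes_Case_Node add_mono)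

lemma run_Call:
  "f < length P \<Longrightarrow> run_list P \<rho> as xs s \<Longrightarrow> run P xs (P ! f) v t \<Longrightarrow>
   run P \<rho> (Call f as) v (s + t + 1)"
  unfolding run_def run_list_def by (blast intro: computes_Call add_mono)

lemma run_Nil: "run_list P \<rho> [] [] 1"
  unfolding run_list_def using computes_Nil by blast

lemma run_Cons:
  "run P \<rho> a x s \<Longrightarrow> run_list P \<rho> as xs t \<Longrightarrow> run_list P \<rho> (a # as) (x # xs) (s + t + 1)"
  unfolding run_def run_list_def by (blast intro: computes_Cons add_mono)

lemma run_link:
  "run P \<rho> e v T \<Longrightarrow> run (A @ map (shift_calls (length A)) P @ B) \<rho> (shift_calls (length A) e) v T"
  unfolding run_def using computes_link(1) by blast


section \<open>Encodable types and polynomial-time functions\<close>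

text \<open>Injectivity allows equality of values to be decided on their encodings.\<close>

class encodable =
  fixes encode :: "'a \<Rightarrow> dat"
  assumes encode_inject: "encode x = encode y \<Longrightarrow> x = y"

lemma encode_eq_iff [simp]: "encode x = encode y \<longleftrightarrow> x = y"
  using encode_inject by blast

instantiation bool :: encodable
begin
definition encode_bool_def: "encode b = (if b then Node Leaf Leaf else Leaf)"
instance by standard (auto simp: encode_bool_def split: if_splits)
end

instantiation nat :: encodable
begin
definition encode_nat_def: "encode n = enc_nat n"
instance
proof
  have "enc_nat m = enc_nat n \<Longrightarrow> m = n" for m n
  proof (induction m arbitrary: n rule: less_induct)
    case (less m)
    show ?case
    proof (cases "m = 0 \<or> n = 0")
      case True
      then show ?thesis using less.prems
        by (subst (asm) (1 2) enc_nat.simps) (auto split: if_splits)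
    next
      case False
      \<comment> \<open>The first subtree determines the parity and the second one, by induction,
        the half; together they determine the number.\<close>
      then have "enc_nat (m div 2) = enc_nat (n div 2)" "even m \<longleftrightarrow> even n"
        using less.prems
        by (subst (asm) (1 2) enc_nat.simps; auto split: if_splits)+
      moreover have "m div 2 = n div 2"
        using less.IH [of "m div 2" "n div 2"] False calculation by auto
      moreover have "m = 2 * (m div 2) + m mod 2" "n = 2 * (n div 2) + n mod 2" by simp_all
      ultimately show ?thesis by (metis parity_cases)
    qed
  qed
  then show "encode m = encode n \<Longrightarrow> m = n" for m n :: nat
    unfolding encode_nat_def .
qed
end

instantiation prod :: (encodable, encodable) encodable
begin
definition encode_prod_def: "encode p = enc_pair encode encode p"
instance by standard (auto simp: encode_prod_def enc_pair_def prod_eq_iff)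
end

instantiation list :: (encodable) encodable
begin
definition encode_list_def: "encode xs = enc_list encode xs"
instance
proof
  show "encode xs = encode ys \<Longrightarrow> xs = ys" for xs ys :: "'a list"
    by (induction xs arbitrary: ys; case_tac ys) (auto simp: encode_list_def enc_list_def)
qed
end

lemma encode_Pair [simp]: "encode (a, b) = Node (encode a) (encode b)"
  by (simp add: encode_prod_def enc_pair_def)

lemma encode_Nil [simp]: "encode [] = Leaf"
  by (simp add: encode_list_def enc_list_def)

lemma encode_Cons [simp]: "encode (x # xs) = Node (encode x) (encode xs)"
  by (simp add: encode_list_def enc_list_def)

lemma encode_True [simp]: "encode True = Node Leaf Leaf"
  and encode_False [simp]: "encode False = Leaf"
  by (simp_all add: encode_bool_def)

abbreviation sz :: "'a::encodable \<Rightarrow> nat" where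
  "sz x \<equiv> size (encode x)"

text \<open>The index \<open>i\<close> lets several functions live in one program; a common exponent
  for time and output size keeps later estimates short.\<close>

definition callable :: "expr list \<Rightarrow> nat \<Rightarrow> ('a::encodable \<Rightarrow> 'b::encodable) \<Rightarrow> nat \<Rightarrow> bool" where
  "callable P i f c \<longleftrightarrow> i < length P \<and>
     (\<forall>x. run P [encode x] (P ! i) (encode (f x)) ((sz x + 2) ^ c) \<and> sz (f x) \<le> (sz x + 2) ^ c)"

text \<open>The output size is bounded separately because a program can build exponentially large
  trees in polynomial time by sharing subtrees.\<close>

definition poly_time :: "('a::encodable \<Rightarrow> 'b::encodable) \<Rightarrow> bool" where
  "poly_time f \<longleftrightarrow> (\<exists>P i c. callable P i f c)"

lemma callable_mono:
  assumes "callable P i f c" "c \<le> d"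
  shows "callable P i f d"
proof -
  have "(sz x + 2) ^ c \<le> (sz x + 2) ^ d" for x :: 'a
    using assms(2) by (intro power_increasing) auto
  then show ?thesis
    using assms(1) unfolding callable_def by (meson le_trans run_mono)
qed

lemma callable_link:
  assumes "callable P i f c"
  shows "callable (A @ map (shift_calls (length A)) P @ B) (length A + i) f c"
  using assms run_link [of P _ "P ! i" _ _ A B] unfolding callable_def by (auto simp: nth_append)

lemma callable_append: "callable P i f c \<Longrightarrow> callable (P @ B) i f c"
  using callable_link [of P i f c "[]" B] by (simp add: map_idI)

text \<open>The second program is relocated behind the first, and the sum of the exponents serves
  both functions.\<close>

lemma callable_pair:
  assumes "poly_time f" "poly_time g"
  obtains P i j c where "callable P i f c" "callable P j g c"
proof -
  obtain P i c Q j d where "callable P i f c" "callable Q j g d"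
    using assms unfolding poly_time_def by blast
  then have "callable (P @ map (shift_calls (length P)) Q) i f (c + d)"
    "callable (P @ map (shift_calls (length P)) Q) (length P + j) g (c + d)"
    using callable_link [of Q j g d P "[]"]
    by (auto intro: callable_append callable_mono)
  then show thesis by (rule that)
qed

lemma callable_triple:
  assumes "poly_time f" "poly_time g" "poly_time h"
  obtains P i j k c where "callable P i f c" "callable P j g c" "callable P k h c"
proof -
  obtain P i j c where "callable P i f c" "callable P j g c"
    using assms(1,2) by (rule callable_pair)
  moreover obtain Q k d where "callable Q k h d"
    using assms unfolding poly_time_def by blast
  ultimately have "callable (P @ map (shift_calls (length P)) Q) i f (c + d)"
    "callable (P @ map (shift_calls (length P)) Q) j g (c + d)"
    "callable (P @ map (shift_calls (length P)) Q) (length P + k) h (c + d)"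
    using callable_link [of Q k h d P "[]"]
    by (auto intro: callable_append callable_mono)
  then show thesis by (rule that)
qed

lemma poly_timeI:
  assumes "\<And>x. run P [encode x] (P ! i) (encode (f x)) (T x)" "i < length P"
    and "\<And>x. T x \<le> p (sz x)" "\<And>x. sz (f x) \<le> q (sz x)" "poly_bounded p" "poly_bounded q"
  shows "poly_time f"
proof -
  have "poly_bounded (\<lambda>n. p n + q n)" using assms(5,6) by (rule poly_bounded_add)
  then obtain c where c: "\<And>n. p n + q n \<le> (n + 2) ^ c" by (meson poly_boundedE)
  have "T x \<le> (sz x + 2) ^ c" "sz (f x) \<le> (sz x + 2) ^ c" for x
    using assms(3,4) [of x] c [of "sz x"] by linarith+
  then have "callable P i f c"
    unfolding callable_def using assms(1,2) run_mono by blast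
  then show ?thesis unfolding poly_time_def by blast
qed

lemma run_call1:
  assumes "callable P i f c" "run P \<rho> e (encode x) s"
  shows "run P \<rho> (Call i [e]) (encode (f x)) (s + (sz x + 2) ^ c + 3)"
proof -
  \<comment> \<open>The argument list takes one step each for its cell and its end, and the call
    takes one more; this makes up the 3.\<close>
  have "run P \<rho> (Call i [e]) (encode (f x)) ((s + 1 + 1) + (sz x + 2) ^ c + 1)"
    using assms unfolding callable_def by (blast intro: run_Call run_Cons run_Nil)
  then show ?thesis by (rule run_mono) simp
qed

lemma callable_size: "callable P i f c \<Longrightarrow> sz (f x) \<le> (sz x + 2) ^ c"
  unfolding callable_def by blast

section \<open>Composition, pairing and branching\<close>

named_theorems pt

text \<open>Only encodings matter, so one program can serve functions with different result types,
  for instance numbers and bit lists.\<close>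

lemma poly_time_cong:
  assumes "poly_time h" "\<And>x. encode (g x) = encode (h x)"
  shows "poly_time g"
  using assms unfolding poly_time_def callable_def by simp

lemma poly_time_same_enc:
  assumes "\<And>x. encode (f x) = encode x"
  shows "poly_time f"
proof (rule poly_timeI [where P = "[Var 0]" and i = 0 and T = "\<lambda>_. 1" and p = "\<lambda>_. 1" and q = "\<lambda>n. n"])
  show "run [Var 0] [encode x] ([Var 0] ! 0) (encode (f x)) 1" for x
    by (simp add: assms run_Var)
qed (auto simp: assms intro: poly_bounded_intros)

lemma poly_time_id [pt]: "poly_time (\<lambda>x. x)"
  by (rule poly_time_same_enc) simp

fun quote_dat :: "dat \<Rightarrow> expr" where
  "quote_dat Leaf = MkLeaf"
| "quote_dat (Node a b) = MkNode (quote_dat a) (quote_dat b)"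

lemma poly_time_const [pt]: "poly_time (\<lambda>_ :: 'b::encodable. a)"
proof -
  have "\<exists>t. \<forall>P \<rho>. computes P \<rho> (quote_dat d) d t" for d
  proof (induction d)
    case Leaf
    show ?case using computes_MkLeaf by auto
  next
    case (Node d1 d2)
    then show ?case using computes_MkNode by (metis quote_dat.simps(2))
  qed
  then obtain t where t: "\<And>P \<rho>. computes P \<rho> (quote_dat (encode a)) (encode a) t" by blast
  show ?thesis
  proof (rule poly_timeI [where P = "[quote_dat (encode a)]" and i = 0 and T = "\<lambda>_. t"
        and p = "\<lambda>_. t" and q = "\<lambda>_. sz a"])
    show "run [quote_dat (encode a)] [encode x] ([quote_dat (encode a)] ! 0) (encode a) t" for x :: 'b
      using t unfolding run_def by auto
  qed (auto intro: poly_bounded_intros)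
qed

text \<open>Here and in later closure proofs a new function at index \<open>length P\<close> calls
  the given ones. The size bound on \<open>g x\<close> turns the time of \<open>f\<close> into a
  polynomial in the size of \<open>x\<close>.\<close>

lemma poly_time_comp:
  assumes "poly_time f" "poly_time g"
  shows "poly_time (\<lambda>x. f (g x))"
proof -
  obtain P i j c where P: "callable P i f c" "callable P j g c"
    using assms by (rule callable_pair)
  let ?b = "Call i [Call j [Var 0]]"
  show ?thesis
  proof (rule poly_timeI [where P = "P @ [?b]" and i = "length P"])
    fix x
    have "run (P @ [?b]) [encode x] ?b (encode (f (g x)))
      (1 + (sz x + 2) ^ c + 3 + (sz (g x) + 2) ^ c + 3)"
      by (intro run_call1 callable_append P run_Var) auto
    then show "run (P @ [?b]) [encode x] ((P @ [?b]) ! length P) (encode (f (g x)))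
      (1 + (sz x + 2) ^ c + 3 + (sz (g x) + 2) ^ c + 3)" by simp
    show "1 + (sz x + 2) ^ c + 3 + (sz (g x) + 2) ^ c + 3 \<le>
      1 + (sz x + 2) ^ c + 3 + ((sz x + 2) ^ c + 2) ^ c + 3"
      using callable_size [OF P(2), of x] by (intro add_mono power_mono) auto
    show "sz (f (g x)) \<le> ((sz x + 2) ^ c + 2) ^ c"
      using callable_size [OF P(1), of "g x"]
        power_mono [of "sz (g x) + 2" "(sz x + 2) ^ c + 2" c] callable_size [OF P(2), of x]
      by simp
  qed (intro poly_bounded_intros | simp)+
qed

text \<open>Pairs and nonempty lists are both encoded by a \<open>Node\<close>, so one program
  covers both constructors.\<close>

lemma poly_time_Node:
  assumes "poly_time f" "poly_time g" and enc_h: "\<And>x. encode (h x) = Node (encode (f x)) (encode (g x))"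
  shows "poly_time h"
proof -
  obtain P i j c where P: "callable P i f c" "callable P j g c"
    using assms(1,2) by (rule callable_pair)
  let ?b = "MkNode (Call i [Var 0]) (Call j [Var 0])"
  let ?T = "\<lambda>n. (1 + (n + 2) ^ c + 3) + (1 + (n + 2) ^ c + 3) + 1"
  show ?thesis
  proof (rule poly_timeI [where P = "P @ [?b]" and i = "length P" and p = ?T])
    fix x
    have "run (P @ [?b]) [encode x] ?b (encode (h x)) (?T (sz x))"
      unfolding enc_h by (intro run_MkNode run_call1 callable_append P run_Var) auto
    then show "run (P @ [?b]) [encode x] ((P @ [?b]) ! length P) (encode (h x)) (?T (sz x))" by simp
    show "sz (h x) \<le> ?T (sz x)"
      unfolding enc_h using callable_size [OF P(1), of x] callable_size [OF P(2), of x] by simp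
  qed (intro poly_bounded_intros | simp)+
qed

lemma poly_time_Pair [pt]: "poly_time f \<Longrightarrow> poly_time g \<Longrightarrow> poly_time (\<lambda>x. (f x, g x))"
  by (rule poly_time_Node) auto

lemma poly_time_Cons [pt]: "poly_time f \<Longrightarrow> poly_time g \<Longrightarrow> poly_time (\<lambda>x. f x # g x)"
  by (rule poly_time_Node) auto

lemma poly_time_fst_raw: "poly_time fst"
\<comment> \<open>A pair is always a node, so the leaf branch is a mere default; the match pushes
  the components as \<open>Var 0\<close> and \<open>Var 1\<close>.\<close>
proof (rule poly_timeI [where P = "[Case (Var 0) MkLeaf (Var 0)]" and i = 0 and T = "\<lambda>_. 1 + 1 + 1"
      and p = "\<lambda>_. 3" and q = "\<lambda>n. n"])
  fix x :: "'a \<times> 'b"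
  show "run [Case (Var 0) MkLeaf (Var 0)] [encode x] ([Case (Var 0) MkLeaf (Var 0)] ! 0)
      (encode (fst x)) (1 + 1 + 1)"
    by (cases x) (simp only: nth_Cons_0 encode_Pair fst_conv snd_conv, intro run_Case_Node run_Var, simp_all)
  show "sz (fst x) \<le> sz x" by (cases x) auto
qed (auto intro: poly_bounded_intros)

lemma poly_time_snd_raw: "poly_time snd"
proof (rule poly_timeI [where P = "[Case (Var 0) MkLeaf (Var 1)]" and i = 0 and T = "\<lambda>_. 1 + 1 + 1"
      and p = "\<lambda>_. 3" and q = "\<lambda>n. n"])
  fix x :: "'a \<times> 'b"
  show "run [Case (Var 0) MkLeaf (Var 1)] [encode x] ([Case (Var 0) MkLeaf (Var 1)] ! 0)
      (encode (snd x)) (1 + 1 + 1)"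
    by (cases x) (simp only: nth_Cons_0 encode_Pair fst_conv snd_conv, intro run_Case_Node run_Var, simp_all)
  show "sz (snd x) \<le> sz x" by (cases x) auto
qed (auto intro: poly_bounded_intros)

lemmas poly_time_fst [pt] = poly_time_comp [OF poly_time_fst_raw]
lemmas poly_time_snd [pt] = poly_time_comp [OF poly_time_snd_raw]

lemma poly_time_If [pt]:
  assumes "poly_time b" "poly_time f" "poly_time g"
  shows "poly_time (\<lambda>x. if b x then f x else g x)"
proof -
  obtain P i j k c where P: "callable P i b c" "callable P j f c" "callable P k g c"
    using assms by (rule callable_triple)
  \<comment> \<open>\<open>False\<close> is a leaf, so \<open>g\<close> sits in the first branch.
    Matching the node for \<open>True\<close> pushes two subtrees, so there the argument has become
    \<open>Var 2\<close>.\<close>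
  let ?b = "Case (Call i [Var 0]) (Call k [Var 0]) (Call j [Var 2])"
  let ?T = "\<lambda>n. (1 + (n + 2) ^ c + 3) + (1 + (n + 2) ^ c + 3) + 1"
  show ?thesis
  proof (rule poly_timeI [where P = "P @ [?b]" and i = "length P" and p = ?T])
    fix x
    have b: "run (P @ [?b]) [encode x] (Call i [Var 0]) (encode (b x)) (1 + (sz x + 2) ^ c + 3)"
      by (intro run_call1 callable_append P run_Var) auto
    have "run (P @ [?b]) [encode x] ?b (encode (if b x then f x else g x)) (?T (sz x))"
    proof (cases "b x")
      case True
      with b have "run (P @ [?b]) [encode x] (Call i [Var 0]) (Node Leaf Leaf) (1 + (sz x + 2) ^ c + 3)"
        by simp
      then show ?thesis
        unfolding if_P [OF True]
        by (rule run_Case_Node) (intro run_call1 callable_append P run_Var, simp_all)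
    next
      case False
      with b have "run (P @ [?b]) [encode x] (Call i [Var 0]) Leaf (1 + (sz x + 2) ^ c + 3)"
        by simp
      then show ?thesis
        unfolding if_not_P [OF False]
        by (rule run_Case_Leaf) (intro run_call1 callable_append P run_Var, simp_all)
    qed
    then show "run (P @ [?b]) [encode x] ((P @ [?b]) ! length P)
      (encode (if b x then f x else g x)) (?T (sz x))" by simp
    show "sz (if b x then f x else g x) \<le> ?T (sz x)"
      using callable_size [OF P(2), of x] callable_size [OF P(3), of x] by simp
  qed (intro poly_bounded_intros | simp)+
qed


section \<open>List matching, folds and equality\<close>

lemma length_le_sz: "length xs \<le> sz xs"
  by (induction xs) auto

lemma sz_member_le: "a \<in> set xs \<Longrightarrow> sz a \<le> sz xs"
  by (induction xs) auto

lemma sz_append [simp]: "sz (xs @ ys) = sz xs + sz ys"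
  by (induction xs) auto

lemma sz_filter_le: "sz (filter Q xs) \<le> sz xs"
  by (induction xs) auto

lemma poly_time_bound: "poly_time f \<Longrightarrow> \<exists>c. \<forall>x. sz (f x) \<le> (sz x + 2) ^ c"
  using callable_size unfolding poly_time_def by blast

lemma poly_time_case_list [pt]:
  assumes "poly_time l" "poly_time f" and g: "poly_time (\<lambda>p. g (fst p) (fst (snd p)) (snd (snd p)))"
  shows "poly_time (\<lambda>x. case l x of [] \<Rightarrow> f x | h # t \<Rightarrow> g x h t)"
proof -
  obtain P i j k c where P: "callable P i l c" "callable P j f c"
    "callable P k (\<lambda>p. g (fst p) (fst (snd p)) (snd (snd p))) c"
    using assms by (rule callable_triple)
  \<comment> \<open>After the match, head, tail and argument are \<open>Var 0\<close>,
    \<open>Var 1\<close> and \<open>Var 2\<close>. They are packed into one value because callable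
    functions take a single argument.\<close>
  let ?b = "Case (Call i [Var 0]) (Call j [Var 0]) (Call k [MkNode (Var 2) (MkNode (Var 0) (Var 1))])"
  let ?F = "\<lambda>x. case l x of [] \<Rightarrow> f x | h # t \<Rightarrow> g x h t"
  \<comment> \<open>Bounds \<open>sz (x, h, t) + 2\<close>, where \<open>h\<close> and
    \<open>t\<close> come from the list \<open>l x\<close> of size at most
    \<open>(n + 2) ^ c\<close>.\<close>
  let ?M = "\<lambda>n. n + (n + 2) ^ c + 4"
  let ?T = "\<lambda>n. (1 + (n + 2) ^ c + 3) + (5 + ?M n ^ c + 3) + 1"
  have *: "run (P @ [?b]) [encode x] ?b (encode (?F x)) (?T (sz x)) \<and> sz (?F x) \<le> ?T (sz x)" for x
  proof -
    have l: "run (P @ [?b]) [encode x] (Call i [Var 0]) (encode (l x)) (1 + (sz x + 2) ^ c + 3)"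
      by (intro run_call1 callable_append P run_Var) auto
    have n_le: "(sz x + 2) ^ c \<le> ?M (sz x) ^ c" by (rule power_mono) auto
    show ?thesis
    proof (cases "l x")
      case Nil
      have "run (P @ [?b]) [encode x] ?b (encode (f x))
        ((1 + (sz x + 2) ^ c + 3) + (1 + (sz x + 2) ^ c + 3) + 1)"
        using l unfolding Nil encode_Nil
        by (rule run_Case_Leaf) (intro run_call1 callable_append P run_Var, simp_all)
      then have "run (P @ [?b]) [encode x] ?b (encode (f x)) (?T (sz x))"
        by (rule run_mono) (use n_le in simp)
      then show ?thesis using Nil callable_size [OF P(2), of x] by simp
    next
      case (Cons h t)
      have "run (P @ [?b]) (encode h # encode t # [encode x])
          (Call k [MkNode (Var 2) (MkNode (Var 0) (Var 1))])
          (encode ((\<lambda>p. g (fst p) (fst (snd p)) (snd (snd p))) (x, h, t)))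
          ((1 + (1 + 1 + 1) + 1) + (sz (x, h, t) + 2) ^ c + 3)"
        by (rule run_call1 [OF callable_append [OF P(3)]], unfold encode_Pair)
          (intro run_MkNode run_Var, simp_all)
      then have r: "run (P @ [?b]) (encode h # encode t # [encode x])
          (Call k [MkNode (Var 2) (MkNode (Var 0) (Var 1))]) (encode (g x h t))
          ((1 + (1 + 1 + 1) + 1) + (sz (x, h, t) + 2) ^ c + 3)" by simp
      have "run (P @ [?b]) [encode x] ?b (encode (g x h t))
        ((1 + (sz x + 2) ^ c + 3) + ((1 + (1 + 1 + 1) + 1) + (sz (x, h, t) + 2) ^ c + 3) + 1)"
        using l [unfolded Cons encode_Cons] r by (rule run_Case_Node)
      moreover have le: "(sz (x, h, t) + 2) ^ c \<le> ?M (sz x) ^ c"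
        using callable_size [OF P(1), of x] by (intro power_mono) (auto simp: Cons)
      ultimately have "run (P @ [?b]) [encode x] ?b (encode (g x h t)) (?T (sz x))"
        by (elim run_mono) (use le in simp)
      then show ?thesis using Cons callable_size [OF P(3), of "(x, h, t)"] le by simp
    qed
  qed
  show ?thesis
  proof (rule poly_timeI [where P = "P @ [?b]" and i = "length P" and p = ?T and q = ?T])
    show "run (P @ [?b]) [encode x] ((P @ [?b]) ! length P) (encode (?F x)) (?T (sz x))" for x
      using * [of x] by simp
    show "sz (?F x) \<le> ?T (sz x)" for x
      using * [of x] by simp
  qed (intro poly_bounded_intros | simp)+
qed

text \<open>The loop function calls itself with the argument, the next state and the rest of the
  list. \<open>M\<close> bounds the states after every prefix and \<open>Z\<close> the list entries,
  so each round works on data of bounded size and the rounds cost the same estimate.\<close>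

lemma run_foldl_loop:
  fixes step :: "'a::encodable \<Rightarrow> 's::encodable \<Rightarrow> 'b::encodable \<Rightarrow> 's"
  assumes P: "callable P j (\<lambda>p. step (fst p) (fst (snd p)) (snd (snd p))) c"
    and loop: "n < length P"
      "P ! n = Case (Var 2) (Var 1) (Call n [Var 2, Call j [MkNode (Var 2) (MkNode (Var 3) (Var 0))], Var 1])"
    and M: "\<And>m. sz (foldl (step x) s (take m xs)) \<le> M"
    and Z: "\<And>a. a \<in> set xs \<Longrightarrow> sz a \<le> Z"
  shows "run P [encode x, encode s, encode xs] (P ! n) (encode (foldl (step x) s xs))
    ((length xs + 1) * ((sz x + M + Z + 4) ^ c + 20))"
  using M Z
proof (induction xs arbitrary: s)
  case Nil
  have "run P [encode x, encode s, encode ([] :: 'b list)] (P ! n) (encode s) (1 + 1 + 1)"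
    unfolding loop(2) encode_Nil by (rule run_Case_Leaf) (rule run_Var; simp)+
  then show ?case by (auto elim: run_mono)
next
  case (Cons a xs)
  let ?D = "(sz x + M + Z + 4) ^ c + 20"
  \<comment> \<open>Positions 0 to 4 hold the head, the tail, the argument, the state and the whole
    list.\<close>
  let ?\<rho> = "encode a # encode xs # [encode x, encode s, encode (a # xs)]"
  have IH: "run P [encode x, encode (step x s a), encode xs] (P ! n)
      (encode (foldl (step x) (step x s a) xs)) ((length xs + 1) * ?D)"
  proof (rule Cons.IH)
    show "sz (foldl (step x) (step x s a) (take m xs)) \<le> M" for m
      using Cons.prems(1) [of "Suc m"] by simp
  qed (use Cons.prems(2) in auto)
  have "run P ?\<rho> (Call j [MkNode (Var 2) (MkNode (Var 3) (Var 0))])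
      (encode ((\<lambda>p. step (fst p) (fst (snd p)) (snd (snd p))) (x, s, a)))
      ((1 + (1 + 1 + 1) + 1) + (sz (x, s, a) + 2) ^ c + 3)"
    by (rule run_call1 [OF P], unfold encode_Pair) (intro run_MkNode run_Var, simp_all)
  then have st: "run P ?\<rho> (Call j [MkNode (Var 2) (MkNode (Var 3) (Var 0))]) (encode (step x s a))
      ((1 + (1 + 1 + 1) + 1) + (sz (x, s, a) + 2) ^ c + 3)" by simp
  have "run P ?\<rho> (Call n [Var 2, Call j [MkNode (Var 2) (MkNode (Var 3) (Var 0))], Var 1])
      (encode (foldl (step x) (step x s a) xs))
      ((1 + (((1 + (1 + 1 + 1) + 1) + (sz (x, s, a) + 2) ^ c + 3) + (1 + 1 + 1) + 1) + 1) +
        (length xs + 1) * ?D + 1)"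
    using loop(1) _ IH by (rule run_Call) (intro run_Cons run_Nil run_Var st, simp_all)
  then have "run P [encode x, encode s, encode (a # xs)] (P ! n)
      (encode (foldl (step x) (step x s a) xs))
      (1 + ((1 + (((1 + (1 + 1 + 1) + 1) + (sz (x, s, a) + 2) ^ c + 3) + (1 + 1 + 1) + 1) + 1) +
        (length xs + 1) * ?D + 1) + 1)"
    unfolding loop(2) by (intro run_Case_Node [where x = "encode a" and y = "encode xs"] run_Var) simp_all
  moreover have "(sz (x, s, a) + 2) ^ c \<le> (sz x + M + Z + 4) ^ c"
    using Cons.prems(1) [of 0] Cons.prems(2) [of a] by (intro power_mono) auto
  ultimately show ?case by (auto elim!: run_mono simp: algebra_simps)
qed

text \<open>A polynomial-time step may square the size of its state, and iterating it would leave
  polynomial size. Hence the bound \<open>B\<close> on all intermediate states.\<close>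

lemma poly_time_foldl:
  fixes step :: "'a::encodable \<Rightarrow> 's::encodable \<Rightarrow> 'b::encodable \<Rightarrow> 's"
  assumes step: "poly_time (\<lambda>p. step (fst p) (fst (snd p)) (snd (snd p)))"
    and s0: "poly_time s0" and l: "poly_time l"
    and B: "poly_bounded B" "\<And>x n. sz (foldl (step x) (s0 x) (take n (l x))) \<le> B (sz x)"
  shows "poly_time (\<lambda>x. foldl (step x) (s0 x) (l x))"
proof -
  obtain P j i k c where P: "callable P j (\<lambda>p. step (fst p) (fst (snd p)) (snd (snd p))) c"
    "callable P i s0 c" "callable P k l c"
    using assms(1,2,3) by (rule callable_triple)
  let ?n = "length P"
  let ?loop = "Case (Var 2) (Var 1)
    (Call ?n [Var 2, Call j [MkNode (Var 2) (MkNode (Var 3) (Var 0))], Var 1])"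
  let ?main = "Call ?n [Var 0, Call i [Var 0], Call k [Var 0]]"
  let ?P = "P @ [?loop, ?main]"
  let ?L = "\<lambda>n. (n + 2) ^ c"
  let ?T = "\<lambda>n. 30 + 2 * ?L n + (?L n + 1) * ((n + B n + ?L n + 4) ^ c + 20)"
  have P': "callable ?P j (\<lambda>p. step (fst p) (fst (snd p)) (snd (snd p))) c"
    "callable ?P i s0 c" "callable ?P k l c"
    using P callable_append by blast+
  have *: "run ?P [encode x] ?main (encode (foldl (step x) (s0 x) (l x))) (?T (sz x))" for x
  proof -
    have "run ?P [encode x, encode (s0 x), encode (l x)] (?P ! ?n)
        (encode (foldl (step x) (s0 x) (l x)))
        ((length (l x) + 1) * ((sz x + B (sz x) + sz (l x) + 4) ^ c + 20))"
      by (rule run_foldl_loop [OF P'(1)]) (use B(2) sz_member_le in auto)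
    then have "run ?P [encode x] ?main (encode (foldl (step x) (s0 x) (l x)))
      ((1 + ((1 + (sz x + 2) ^ c + 3) + ((1 + (sz x + 2) ^ c + 3) + 1 + 1) + 1) + 1) +
        (length (l x) + 1) * ((sz x + B (sz x) + sz (l x) + 4) ^ c + 20) + 1)"
      by (rule run_Call [rotated 2]) (simp, intro run_Cons run_Nil run_call1 P' run_Var, simp_all)
    moreover have "(length (l x) + 1) * ((sz x + B (sz x) + sz (l x) + 4) ^ c + 20)
        \<le> (?L (sz x) + 1) * ((sz x + B (sz x) + ?L (sz x) + 4) ^ c + 20)"
      using callable_size [OF P(3), of x] le_trans [OF length_le_sz callable_size [OF P(3), of x]]
      by (intro mult_mono add_mono power_mono) auto
    ultimately show ?thesis by (auto elim!: run_mono)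
  qed
  show ?thesis
  proof (rule poly_timeI [where P = ?P and i = "Suc ?n" and p = ?T and q = B])
    show "run ?P [encode x] (?P ! Suc ?n) (encode (foldl (step x) (s0 x) (l x))) (?T (sz x))" for x
      using * [of x] by (simp add: nth_append)
    show "sz (foldl (step x) (s0 x) (l x)) \<le> B (sz x)" for x
      using B(2) [of x "length (l x)"] by simp
    show "poly_bounded ?T"
      by (intro poly_bounded_intros B(1))
  qed (use B(1) in auto)
qed

text \<open>The growth allowed per step does not depend on the current state, so the total growth is
  at most the length of the list times a polynomial.\<close>

lemma poly_time_foldl_additive:
  fixes step :: "'a::encodable \<Rightarrow> 's::encodable \<Rightarrow> 'b::encodable \<Rightarrow> 's"
  assumes step: "poly_time (\<lambda>p. step (fst p) (fst (snd p)) (snd (snd p)))"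
    and s0: "poly_time s0" and l: "poly_time l"
    and B: "poly_bounded B" "\<And>x s a. a \<in> set (l x) \<Longrightarrow> sz (step x s a) \<le> sz s + B (sz x + sz a)"
  shows "poly_time (\<lambda>x. foldl (step x) (s0 x) (l x))"
proof -
  obtain b where b: "\<And>n. B n \<le> (n + 2) ^ b" using B(1) by (meson poly_boundedE)
  obtain c where c: "\<And>x. sz (s0 x) \<le> (sz x + 2) ^ c" using poly_time_bound [OF s0] by blast
  obtain d where d: "\<And>x. sz (l x) \<le> (sz x + 2) ^ d" using poly_time_bound [OF l] by blast
  let ?L = "\<lambda>n. (n + 2) ^ d"
  have *: "sz (foldl (step x) s xs) \<le> sz s + length xs * (sz x + ?L (sz x) + 2) ^ b"
    if "set xs \<subseteq> set (l x)" for x s xs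
    using that
  proof (induction xs arbitrary: s)
    case (Cons a xs)
    have "sz a \<le> ?L (sz x)"
      using Cons.prems le_trans [OF sz_member_le d] by auto
    then have "B (sz x + sz a) \<le> (sz x + ?L (sz x) + 2) ^ b"
      by (intro le_trans [OF b] power_mono) auto
    then have "sz (step x s a) \<le> sz s + (sz x + ?L (sz x) + 2) ^ b"
      using B(2) [of a x s] Cons.prems by simp
    then show ?case
      using Cons.IH [of "step x s a"] Cons.prems by simp
  qed simp
  show ?thesis
  proof (rule poly_time_foldl [OF step s0 l])
    show "poly_bounded (\<lambda>n. (n + 2) ^ c + ?L n * (n + ?L n + 2) ^ b)"
      by (intro poly_bounded_intros)
    show "sz (foldl (step x) (s0 x) (take n (l x))) \<le>
      (sz x + 2) ^ c + ?L (sz x) * (sz x + ?L (sz x) + 2) ^ b" for x n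
    proof -
      have "length (take n (l x)) \<le> ?L (sz x)"
        using length_le_sz [of "l x"] d [of x] by simp
      then have "length (take n (l x)) * (sz x + ?L (sz x) + 2) ^ b \<le>
          ?L (sz x) * (sz x + ?L (sz x) + 2) ^ b"
        by (rule mult_right_mono) simp
      then show ?thesis
        using * [of "take n (l x)" x "s0 x"] c [of x] set_take_subset [of n "l x"] by linarith
    qed
  qed
qed

text \<open>The program descends into both trees at once and compares the right subtrees only if the
  left ones agree. \<open>2 * size a + 1\<close> counts the nodes and leaves of \<open>a\<close>,
  and 40 is a generous cost for each.\<close>

lemma run_dat_eq:
  assumes "0 < length P"
    "P ! 0 = Case (Var 0) (Case (Var 1) (MkNode MkLeaf MkLeaf) MkLeaf)
      (Case (Var 3) MkLeaf (Case (Call 0 [Var 2, Var 0]) MkLeaf (Call 0 [Var 5, Var 3])))"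
  shows "run P [a, b] (P ! 0) (encode (a = b)) (40 * (2 * size a + 1))"
proof (induction a arbitrary: b)
  case Leaf
  show ?case
  proof (cases b)
    case Leaf
    have "run P [Leaf, Leaf] (P ! 0) (Node Leaf Leaf) (1 + (1 + (1 + 1 + 1) + 1) + 1)"
      unfolding assms(2) by (intro run_Case_Leaf run_MkNode run_MkLeaf run_Var) simp_all
    then show ?thesis using Leaf by (auto elim: run_mono)
  next
    case (Node b1 b2)
    have "run P [Leaf, Node b1 b2] (P ! 0) Leaf (1 + (1 + 1 + 1) + 1)"
      unfolding assms(2)
      by (rule run_Case_Leaf, rule run_Var, simp, simp, rule run_Case_Node, rule run_Var)
        (simp_all add: run_MkLeaf)
    then show ?thesis using Node by (auto elim: run_mono)
  qed
next
  case (Node a1 a2)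
  show ?case
  proof (cases b)
    case Leaf
    have "run P [Node a1 a2, Leaf] (P ! 0) Leaf (1 + (1 + 1 + 1) + 1)"
      unfolding assms(2)
      by (rule run_Case_Node, rule run_Var, simp, simp, rule run_Case_Leaf, rule run_Var)
        (simp_all add: run_MkLeaf)
    then show ?thesis using Leaf by (auto elim: run_mono)
  next
    case (Node b1 b2)
    let ?\<rho> = "b1 # b2 # a1 # a2 # [Node a1 a2, Node b1 b2]"
    let ?e = "Case (Call 0 [Var 2, Var 0]) MkLeaf (Call 0 [Var 5, Var 3])"
    have l: "run P ?\<rho> (Call 0 [Var 2, Var 0]) (encode (a1 = b1))
        ((1 + (1 + 1 + 1) + 1) + 40 * (2 * size a1 + 1) + 1)"
      using assms(1) _ Node.IH(1) by (rule run_Call) (intro run_Cons run_Nil run_Var, simp_all)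
    \<comment> \<open>A successful first comparison returns a node; its two subtrees are pushed,
      which moves \<open>a2\<close> and \<open>b2\<close> to positions 5 and 3.\<close>
    have r: "run P (x # y # ?\<rho>) (Call 0 [Var 5, Var 3]) (encode (a2 = b2))
        ((1 + (1 + 1 + 1) + 1) + 40 * (2 * size a2 + 1) + 1)" for x y
      using assms(1) _ Node.IH(2) by (rule run_Call) (intro run_Cons run_Nil run_Var, simp_all)
    have e: "run P ?\<rho> ?e (encode (Node a1 a2 = Node b1 b2))
        (((1 + (1 + 1 + 1) + 1) + 40 * (2 * size a1 + 1) + 1) +
         ((1 + (1 + 1 + 1) + 1) + 40 * (2 * size a2 + 1) + 1) + 1)"
    proof (cases "a1 = b1")
      case True
      then have "run P ?\<rho> (Call 0 [Var 2, Var 0]) (Node Leaf Leaf)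
        ((1 + (1 + 1 + 1) + 1) + 40 * (2 * size a1 + 1) + 1)" using l by simp
      then have "run P ?\<rho> ?e (encode (a2 = b2))
        (((1 + (1 + 1 + 1) + 1) + 40 * (2 * size a1 + 1) + 1) +
         ((1 + (1 + 1 + 1) + 1) + 40 * (2 * size a2 + 1) + 1) + 1)"
        using r by (rule run_Case_Node)
      then show ?thesis using True by simp
    next
      case False
      then have "run P ?\<rho> (Call 0 [Var 2, Var 0]) Leaf
        ((1 + (1 + 1 + 1) + 1) + 40 * (2 * size a1 + 1) + 1)" using l by simp
      then have "run P ?\<rho> ?e Leaf
        (((1 + (1 + 1 + 1) + 1) + 40 * (2 * size a1 + 1) + 1) + 1 + 1)"
        using run_MkLeaf by (rule run_Case_Leaf)
      then show ?thesis using False by (auto elim: run_mono)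
    qed
    have "run P [Node a1 a2, Node b1 b2] (P ! 0) (encode (Node a1 a2 = Node b1 b2))
      (1 + (1 + (((1 + (1 + 1 + 1) + 1) + 40 * (2 * size a1 + 1) + 1) +
         ((1 + (1 + 1 + 1) + 1) + 40 * (2 * size a2 + 1) + 1) + 1) + 1) + 1)"
      unfolding assms(2)
      by (rule run_Case_Node, rule run_Var, simp, simp, rule run_Case_Node, rule run_Var, simp, simp,
          rule e)
    then show ?thesis using Node by (auto elim!: run_mono)
  qed
qed

lemma poly_time_eq_raw: "poly_time (\<lambda>p. fst p = (snd p :: 'a::encodable))"
proof -
  let ?eq = "Case (Var 0) (Case (Var 1) (MkNode MkLeaf MkLeaf) MkLeaf)
      (Case (Var 3) MkLeaf (Case (Call 0 [Var 2, Var 0]) MkLeaf (Call 0 [Var 5, Var 3])))"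
  let ?main = "Case (Var 0) MkLeaf (Call 0 [Var 0, Var 1])"
  let ?T = "\<lambda>n. 1 + (5 + 40 * (2 * n + 1) + 1) + 1"
  show ?thesis
  proof (rule poly_timeI [where P = "[?eq, ?main]" and i = 1 and p = ?T and q = "\<lambda>_. 1"])
    fix p :: "'a \<times> 'a"
    obtain x y where p: "p = (x, y)" by (cases p)
    have "run [?eq, ?main] [encode x, encode y] ([?eq, ?main] ! 0) (encode (encode x = encode y))
        (40 * (2 * sz x + 1))"
      by (rule run_dat_eq) auto
    then have "run [?eq, ?main] (encode x # encode y # [encode p]) (Call 0 [Var 0, Var 1])
        (encode (encode x = encode y)) ((1 + (1 + 1 + 1) + 1) + 40 * (2 * sz x + 1) + 1)"
      by (rule run_Call [rotated 2]) (simp, intro run_Cons run_Nil run_Var, simp_all)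
    then have "run [?eq, ?main] [encode p] ?main (encode (fst p = snd p))
        (1 + ((1 + (1 + 1 + 1) + 1) + 40 * (2 * sz x + 1) + 1) + 1)"
      by (intro run_Case_Node [where x = "encode x" and y = "encode y"] run_Var) (simp_all add: p)
    then show "run [?eq, ?main] [encode p] ([?eq, ?main] ! 1) (encode (fst p = snd p)) (?T (sz p))"
      by (auto elim!: run_mono simp: p)
  qed (auto simp: encode_bool_def intro!: poly_bounded_intros)
qed

section \<open>Logical connectives and list functions\<close>

lemma poly_time_comp2:
  "poly_time (\<lambda>p. F (fst p) (snd p)) \<Longrightarrow> poly_time f \<Longrightarrow> poly_time g \<Longrightarrow> poly_time (\<lambda>x. F (f x) (g x))"
  using poly_time_comp [OF _ poly_time_Pair, of "\<lambda>p. F (fst p) (snd p)" f g] by simp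

lemma poly_time_eq [pt]: "poly_time f \<Longrightarrow> poly_time g \<Longrightarrow> poly_time (\<lambda>x. f x = g x)"
  by (rule poly_time_comp2 [OF poly_time_eq_raw])

lemma poly_time_Not [pt]: "poly_time f \<Longrightarrow> poly_time (\<lambda>x. \<not> f x)"
  by (rule poly_time_cong [where h = "\<lambda>x. if f x then False else True"]) (intro pt, auto)

lemma poly_time_conj [pt]: "poly_time f \<Longrightarrow> poly_time g \<Longrightarrow> poly_time (\<lambda>x. f x \<and> g x)"
  by (rule poly_time_cong [where h = "\<lambda>x. if f x then g x else False"]) (intro pt, auto)

lemma poly_time_disj [pt]: "poly_time f \<Longrightarrow> poly_time g \<Longrightarrow> poly_time (\<lambda>x. f x \<or> g x)"
  by (rule poly_time_cong [where h = "\<lambda>x. if f x then True else g x"]) (intro pt, auto)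

lemma foldl_Cons_rev: "foldl (\<lambda>s a. a # s) ys xs = rev xs @ ys"
  by (induction xs arbitrary: ys) auto

lemma poly_time_rev [pt]:
  assumes "poly_time l"
  shows "poly_time (\<lambda>x. rev (l x))"
proof -
  have "poly_time (\<lambda>x. foldl (\<lambda>s a. a # s) [] (l x))"
    by (rule poly_time_foldl_additive [where B = "\<lambda>n. n + 1"])
      (auto intro!: pt assms poly_bounded_intros)
  then show ?thesis by (simp add: foldl_Cons_rev)
qed

lemma poly_time_append [pt]:
  assumes "poly_time l" "poly_time m"
  shows "poly_time (\<lambda>x. l x @ m x)"
proof -
  have "poly_time (\<lambda>x. foldl (\<lambda>s a. a # s) (m x) (rev (l x)))"
    by (rule poly_time_foldl_additive [where B = "\<lambda>n. n + 1"])
      (auto intro!: pt assms poly_bounded_intros)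
  then show ?thesis by (simp add: foldl_Cons_rev)
qed

lemma poly_time_map [pt]:
  assumes f: "poly_time (\<lambda>p. f (fst p) (snd p))" and l: "poly_time l"
  shows "poly_time (\<lambda>x. map (f x) (l x))"
proof -
  obtain c where c: "\<And>p. sz (f (fst p) (snd p)) \<le> (sz p + 2) ^ c"
    using poly_time_bound [OF f] by blast
  \<comment> \<open>A left fold collects the results in reverse order; a final \<open>rev\<close>
    restores the order.\<close>
  have "poly_time (\<lambda>x. foldl (\<lambda>s a. f x a # s) [] (l x))"
  proof (rule poly_time_foldl_additive [where B = "\<lambda>n. (n + 3) ^ c + 1"])
    show "sz (f x a # s) \<le> sz s + ((sz x + sz a + 3) ^ c + 1)" for x s a
      using c [of "(x, a)"] by (simp add: add.commute add.left_commute)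
    show "poly_time (\<lambda>p. f (fst p) (snd (snd p)) # fst (snd p))"
      by (intro pt poly_time_comp2 [OF f])
  qed (auto intro!: pt l poly_bounded_intros)
  moreover have "foldl (\<lambda>s a. f x a # s) ys xs = rev (map (f x) xs) @ ys" for x ys xs
    by (induction xs arbitrary: ys) auto
  ultimately have "poly_time (\<lambda>x. rev (map (f x) (l x)))" by simp
  from poly_time_rev [OF this] show ?thesis by simp
qed

lemma poly_time_filter [pt]:
  assumes f: "poly_time (\<lambda>p. Q (fst p) (snd p))" and l: "poly_time l"
  shows "poly_time (\<lambda>x. filter (Q x) (l x))"
proof -
  have "poly_time (\<lambda>x. foldl (\<lambda>s a. if Q x a then a # s else s) [] (l x))"
  proof (rule poly_time_foldl_additive [where B = "\<lambda>n. n + 1"])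
    show "poly_time (\<lambda>p. if Q (fst p) (snd (snd p)) then snd (snd p) # fst (snd p) else fst (snd p))"
      by (intro pt poly_time_comp2 [OF f])
  qed (auto intro!: pt l poly_bounded_intros)
  moreover have "foldl (\<lambda>s a. if Q x a then a # s else s) ys xs = rev (filter (Q x) xs) @ ys" for x ys xs
    by (induction xs arbitrary: ys) auto
  ultimately have "poly_time (\<lambda>x. rev (filter (Q x) (l x)))" by simp
  from poly_time_rev [OF this] show ?thesis by simp
qed

lemma poly_time_list_ex [pt]:
  assumes f: "poly_time (\<lambda>p. Q (fst p) (snd p))" and l: "poly_time l"
  shows "poly_time (\<lambda>x. list_ex (Q x) (l x))"
proof -
  have "list_ex (Q x) xs \<longleftrightarrow> \<not> filter (Q x) xs = []" for x xs
    by (auto simp: list_ex_iff filter_empty_conv)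
  moreover have "poly_time (\<lambda>x. \<not> filter (Q x) (l x) = [])"
    by (intro pt f l)
  ultimately show ?thesis by simp
qed

lemma poly_time_member [pt]:
  assumes "poly_time f" "poly_time l"
  shows "poly_time (\<lambda>x. f x \<in> set (l x))"
proof -
  have "poly_time (\<lambda>x. list_ex (\<lambda>a. a = f x) (l x))"
    by (intro pt assms poly_time_comp [OF assms(1)])
  then show ?thesis by (simp add: list_ex_iff)
qed

lemma poly_time_concat [pt]:
  assumes "poly_time l"
  shows "poly_time (\<lambda>x. concat (l x))"
proof -
  have "poly_time (\<lambda>x. foldl (\<lambda>s a. s @ a) [] (l x))"
    by (rule poly_time_foldl_additive [where B = "\<lambda>n. n"]) (auto intro!: pt assms poly_bounded_intros)
  moreover have "foldl (\<lambda>s a. s @ a) ys xs = ys @ concat xs" for ys and xs :: "'b list list"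
    by (induction xs arbitrary: ys) auto
  ultimately show ?thesis by simp
qed

lemma poly_time_product [pt]:
  assumes "poly_time l" "poly_time m"
  shows "poly_time (\<lambda>x. List.product (l x) (m x))"
  unfolding product_concat_map by (intro pt assms poly_time_comp [OF assms(2)])

lemma poly_time_zip [pt]:
  assumes "poly_time l" "poly_time m"
  shows "poly_time (\<lambda>x. zip (l x) (m x))"
proof -
  \<comment> \<open>The fold runs over the first list; its state holds the rest of the second list
    and the reversed pairs. Once that rest is empty, the state no longer changes.\<close>
  define step where "step s a = (case fst s of [] \<Rightarrow> s | b # bs \<Rightarrow> (bs, (a, b) # snd s))"
    for s :: "'c list \<times> ('b \<times> 'c) list" and a :: 'b
  have fold: "rev (snd (foldl step (ys, zs) xs)) = rev zs @ zip xs ys" for xs ys zs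
    by (induction xs arbitrary: ys zs) (auto simp: step_def split: list.splits)
  have "poly_time (\<lambda>x. foldl step (m x, []) (l x))"
  proof (rule poly_time_foldl_additive [where B = "\<lambda>n. n + 2"])
    show "poly_time (\<lambda>p. step (fst (snd p)) (snd (snd p)))"
      unfolding step_def by (intro pt)
    show "sz (step s a) \<le> sz s + (sz x + sz a + 2)" for x :: 'a and s a
      by (cases s) (auto simp: step_def split: list.splits)
  qed (auto intro!: pt assms poly_bounded_intros)
  then have "poly_time (\<lambda>x. rev (snd (foldl step (m x, []) (l x))))"
    by (intro pt)
  then show ?thesis by (simp add: fold)
qed


section \<open>Binary arithmetic\<close>

text \<open>A number and its bit list have the same encoding, so a number can be treated as a list
  without conversion.\<close>

fun bits :: "nat \<Rightarrow> bool list" where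
  "bits n = (if n = 0 then [] else odd n # bits (n div 2))"

declare bits.simps [simp del]

fun val :: "bool list \<Rightarrow> nat" where
  "val [] = 0"
| "val (b # bs) = of_bool b + 2 * val bs"

lemma val_bits [simp]: "val (bits n) = n"
proof (induction n rule: bits.induct)
  case (1 n)
  then show ?case by (subst bits.simps) (auto simp: odd_two_times_div_two_nat)
qed

lemma encode_bits: "encode (bits n) = encode n"
proof (induction n rule: bits.induct)
  case (1 n)
  then show ?case
    unfolding encode_nat_def by (subst bits.simps, subst enc_nat.simps) simp
qed

lemma val_append: "val (xs @ ys) = val xs + 2 ^ length xs * val ys"
  by (induction xs) (auto simp: algebra_simps)

lemma val_less: "val xs < 2 ^ length xs"
  by (induction xs) auto

lemma val_padding [simp]: "val (map (\<lambda>_. False) xs) = 0"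
  by (induction xs) auto

lemma poly_time_bits_raw: "poly_time bits"
  by (rule poly_time_same_enc) (rule encode_bits)

lemmas poly_time_bits [pt] = poly_time_comp [OF poly_time_bits_raw]

text \<open>Padding each list by the full length of the other makes the lengths agree without
  comparing them.\<close>

definition aligned :: "bool list \<Rightarrow> bool list \<Rightarrow> (bool \<times> bool) list" where
  "aligned xs ys = zip (xs @ map (\<lambda>_. False) ys) (ys @ map (\<lambda>_. False) xs)"

lemma poly_time_aligned [pt]:
  "poly_time f \<Longrightarrow> poly_time g \<Longrightarrow> poly_time (\<lambda>x. aligned (f x) (g x))"
  unfolding aligned_def by (intro pt)

lemma val_aligned [simp]:
  "val (map fst (aligned xs ys)) = val xs" "val (map snd (aligned xs ys)) = val ys"
  by (simp_all add: aligned_def val_append)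

lemma length_aligned [simp]: "length (aligned xs ys) = length xs + length ys"
  by (simp add: aligned_def)

text \<open>Bits come least significant first, so the last position with a difference decides and
  overrides earlier ones.\<close>

definition le_bits :: "bool list \<Rightarrow> bool list \<Rightarrow> bool" where
  "le_bits xs ys = foldl (\<lambda>r p. if fst p = snd p then r else snd p) True (aligned xs ys)"

lemma le_bits_iff: "le_bits xs ys \<longleftrightarrow> val xs \<le> val ys"
proof -
  have "foldl (\<lambda>r p. if fst p = snd p then r else snd p) True ps \<longleftrightarrow>
      val (map fst ps) \<le> val (map snd ps)" for ps
  proof (induction ps rule: rev_induct)
    case (snoc p ps)
    have "val (map fst ps) < 2 ^ length ps" "val (map snd ps) < 2 ^ length ps"
      using val_less [of "map fst ps"] val_less [of "map snd ps"] by simp_all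
    with snoc show ?case by (auto simp: val_append)
  qed simp
  then show ?thesis by (simp add: le_bits_def)
qed

lemma poly_time_le_bits [pt]:
  assumes "poly_time f" "poly_time g"
  shows "poly_time (\<lambda>x. le_bits (f x) (g x))"
  unfolding le_bits_def
  by (rule poly_time_foldl_additive [where B = "\<lambda>_. 1"])
    ((intro pt assms poly_bounded_intros)+, simp add: encode_bool_def)

lemma poly_time_le_nat [pt]:
  assumes "poly_time f" "poly_time g"
  shows "poly_time (\<lambda>x. f x \<le> (g x :: nat))"
proof -
  have "poly_time (\<lambda>x. le_bits (bits (f x)) (bits (g x)))"
    by (intro pt assms)
  then show ?thesis by (simp add: le_bits_iff)
qed

text \<open>The state holds the carry and the reversed output. Equal bits determine the next carry,
  unequal bits pass it on; \<open>(a = b) = c\<close> is the parity of the three bits.\<close>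

definition add_step :: "bool \<times> bool list \<Rightarrow> bool \<times> bool \<Rightarrow> bool \<times> bool list" where
  "add_step s p =
    ((if fst p = snd p then fst p else fst s), ((fst p = snd p) = fst s) # snd s)"

lemma add_step_Pair:
  "add_step (c, out) (a, b) = (if a = b then a else c, ((a = b) = c) # out)"
  by (simp add: add_step_def)

definition add_bits :: "bool list \<Rightarrow> bool list \<Rightarrow> bool list" where
  "add_bits xs ys =
    rev (snd (foldl add_step (False, []) (aligned xs ys))) @
    [fst (foldl add_step (False, []) (aligned xs ys))]"

text \<open>Loop invariant of binary addition: the carry has the weight of the position after those
  processed.\<close>

lemma foldl_add_step:
  "length (snd (foldl add_step (False, []) ps)) = length ps \<and>
   val (rev (snd (foldl add_step (False, []) ps))) +
     2 ^ length ps * of_bool (fst (foldl add_step (False, []) ps)) =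
   val (map fst ps) + val (map snd ps)"
proof (induction ps rule: rev_induct)
  case (snoc p ps)
  obtain c out where s: "foldl add_step (False, []) ps = (c, out)" by (cases "foldl add_step (False, []) ps")
  with snoc have "length out = length ps"
    "val (rev out) + 2 ^ length ps * of_bool c = val (map fst ps) + val (map snd ps)"
    by auto
  moreover obtain a b where "p = (a, b)" by (cases p)
  ultimately show ?case
    by (cases a; cases b; cases c) (simp_all add: s add_step_Pair val_append)
qed simp

lemma val_add_bits [simp]: "val (add_bits xs ys) = val xs + val ys"
  using foldl_add_step [of "aligned xs ys"] by (simp add: add_bits_def val_append)

lemma length_add_bits [simp]: "length (add_bits xs ys) = length xs + length ys + 1"
  using foldl_add_step [of "aligned xs ys"] by (simp add: add_bits_def)

lemma poly_time_add_bits [pt]: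
  assumes "poly_time f" "poly_time g"
  shows "poly_time (\<lambda>x. add_bits (f x) (g x))"
proof -
  have "poly_time (\<lambda>x. foldl add_step (False, []) (aligned (f x) (g x)))"
  proof (rule poly_time_foldl_additive [where B = "\<lambda>_. 4"])
    show "poly_time (\<lambda>p. add_step (fst (snd p)) (snd (snd p)))"
      unfolding add_step_def by (intro pt)
    show "sz (add_step s a) \<le> sz s + 4" for s a
      by (cases s) (auto simp: add_step_def encode_bool_def)
  qed (intro pt assms poly_bounded_intros)+
  then show ?thesis unfolding add_bits_def by (intro pt)
qed

text \<open>Horner scheme from the most significant bit; putting \<open>False\<close> in front
  doubles the accumulator.\<close>

definition mult_bits :: "bool list \<Rightarrow> bool list \<Rightarrow> bool list" where
  "mult_bits xs ys =
    foldl (\<lambda>acc b. if b then add_bits (False # acc) ys else False # acc) [] (rev xs)"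

lemma val_mult_bits [simp]: "val (mult_bits xs ys) = val xs * val ys"
  unfolding mult_bits_def by (induction xs) (auto simp: algebra_simps)

lemma sz_bits_le: "sz bs \<le> 2 * length (bs :: bool list)"
  by (induction bs) (auto simp: encode_bool_def)

lemma poly_time_mult_bits [pt]:
  assumes f: "poly_time f" and g: "poly_time g"
  shows "poly_time (\<lambda>x. mult_bits (f x) (g x))"
proof -
  let ?step = "\<lambda>x acc b. if b then add_bits (False # acc) (g x) else False # acc"
  obtain c where c: "\<And>x. sz (f x) \<le> (sz x + 2) ^ c" using poly_time_bound [OF f] by blast
  obtain d where d: "\<And>x. sz (g x) \<le> (sz x + 2) ^ d" using poly_time_bound [OF g] by blast
  \<comment> \<open>Growth is tracked through lengths, which are known exactly for sums; each bit
    then contributes at most 2 to the size.\<close>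
  have len: "length (foldl (?step x) acc bs) \<le> length acc + length bs * (length (g x) + 2)"
    for x acc bs
  proof (induction bs arbitrary: acc)
    case (Cons b bs)
    show ?case
      using Cons.IH [of "?step x acc b"] by (cases b) auto
  qed simp
  show ?thesis
    unfolding mult_bits_def
  proof (rule poly_time_foldl)
    show "poly_time (\<lambda>p. if snd (snd p) then add_bits (False # fst (snd p)) (g (fst p))
        else False # fst (snd p))"
      by (intro pt poly_time_comp [OF g])
    show "poly_bounded (\<lambda>n. 2 * ((n + 2) ^ c * ((n + 2) ^ d + 2)))"
      by (intro poly_bounded_intros)
    show "sz (foldl (?step x) [] (take n (rev (f x)))) \<le> 2 * ((sz x + 2) ^ c * ((sz x + 2) ^ d + 2))"
      for x n
    proof -
      have "length (take n (rev (f x))) * (length (g x) + 2) \<le> (sz x + 2) ^ c * ((sz x + 2) ^ d + 2)"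
        using le_trans [OF length_le_sz c [of x]] le_trans [OF length_le_sz d [of x]]
        by (intro mult_mono) auto
      then show ?thesis
        using sz_bits_le [of "foldl (?step x) [] (take n (rev (f x)))"]
          len [of x "[]" "take n (rev (f x))"] by simp
    qed
  qed (intro pt f)+
qed

section \<open>Successor and counting\<close>

definition inc_step :: "bool \<times> bool list \<Rightarrow> bool \<Rightarrow> bool \<times> bool list" where
  "inc_step s b = ((fst s \<and> b), (\<not> (b = fst s)) # snd s)"

lemma inc_step_Pair: "inc_step (c, out) b = (c \<and> b, (b \<noteq> c) # out)"
  by (simp add: inc_step_def)

definition inc_bits :: "bool list \<Rightarrow> bool list" where
  "inc_bits bs = rev (if fst (foldl inc_step (True, []) bs)
     then True # snd (foldl inc_step (True, []) bs) else snd (foldl inc_step (True, []) bs))"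

lemma bits_Suc: "bits (Suc n) = inc_bits (bits n)"
proof -
  have no_carry: "foldl inc_step (False, out) bs = (False, rev bs @ out)" for out bs
    by (induction bs arbitrary: out) (auto simp: inc_step_Pair)
  have "rev (if fst (foldl inc_step (True, out) (bits n))
     then True # snd (foldl inc_step (True, out) (bits n)) else snd (foldl inc_step (True, out) (bits n)))
     = rev out @ bits (Suc n)" for out
  proof (induction n arbitrary: out rule: bits.induct)
    case (1 n)
    show ?case
    proof (cases "n = 0")
      case True
      then show ?thesis by (simp add: bits.simps)
    next
      case False
      \<comment> \<open>For odd \<open>n\<close> the carry continues into \<open>n div 2\<close>;
        for even \<open>n\<close> it stops and the other bits are copied.\<close>
      show ?thesis
      proof (cases "odd n")
        case True
        then have "Suc n div 2 = Suc (n div 2)" by (simp add: odd_Suc_div_two)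
        then show ?thesis
          using 1 [OF False, of "False # out"] True False
          by (subst (1 2 3) bits.simps [of n], subst bits.simps [of "Suc n"]) (auto simp: inc_step_Pair split: if_splits)
      next
        case even: False
        then have "Suc n div 2 = n div 2" by simp
        then show ?thesis
          using even False
          by (subst (1 2 3) bits.simps [of n], subst bits.simps [of "Suc n"])
            (simp add: inc_step_Pair no_carry)
      qed
    qed
  qed
  from this [of "[]"] show ?thesis by (simp add: inc_bits_def)
qed

lemma poly_time_Suc [pt]:
  assumes "poly_time f"
  shows "poly_time (\<lambda>x. Suc (f x))"
proof (rule poly_time_cong)
  have "poly_time (\<lambda>x. foldl inc_step (True, []) (bits (f x)))"
  proof (rule poly_time_foldl_additive [where B = "\<lambda>_. 4"])
    show "poly_time (\<lambda>p. inc_step (fst (snd p)) (snd (snd p)))"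
      unfolding inc_step_def by (intro pt)
    show "sz (inc_step s a) \<le> sz s + 4" for s a
      by (cases s) (auto simp: inc_step_def encode_bool_def)
  qed (intro pt assms poly_bounded_intros)+
  then show "poly_time (\<lambda>x. inc_bits (bits (f x)))"
    unfolding inc_bits_def by (intro pt)
  show "encode (Suc (f x)) = encode (inc_bits (bits (f x)))" for x
    by (simp add: bits_Suc [symmetric] encode_bits)
qed

text \<open>A crude bound, sufficient for counters that stay below the length of a list.\<close>

lemma sz_nat_le: "sz (n :: nat) \<le> 2 * n"
proof -
  have "length (bits n) \<le> n"
  proof (induction n rule: bits.induct)
    case (1 n)
    then show ?case by (subst bits.simps) auto
  qed
  then show ?thesis using sz_bits_le [of "bits n"] by (simp add: encode_bits)
qed

lemma foldl_upt: "foldl (\<lambda>s _. (Suc (fst s), fst s # snd s)) (0, []) xs = (length xs, rev [0..<length xs])"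
  by (induction xs rule: rev_induct) auto

text \<open>Counting along a list keeps the result polynomial; the interval below a number given in
  binary could be exponentially long.\<close>

lemma poly_time_upt_length [pt]:
  assumes "poly_time l"
  shows "poly_time (\<lambda>x. [0..<length (l x)])"
proof -
  obtain c where c: "\<And>x. sz (l x) \<le> (sz x + 2) ^ c" using poly_time_bound [OF assms] by blast
  have sz_upt: "sz (rev [0..<n]) \<le> n * (2 * n + 1)" for n
  proof (induction n)
    case (Suc n)
    then show ?case using sz_nat_le [of n] by (simp add: algebra_simps)
  qed simp
  have "poly_time (\<lambda>x. foldl (\<lambda>s _. (Suc (fst s), fst s # snd s)) (0, []) (l x))"
  proof (rule poly_time_foldl)
    show "poly_bounded (\<lambda>n. 2 * (n + 2) ^ c + (n + 2) ^ c * (2 * (n + 2) ^ c + 1) + 1)"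
      by (intro poly_bounded_intros)
    show "sz (foldl (\<lambda>s _. (Suc (fst s), fst s # snd s)) (0, []) (take n (l x))) \<le>
      2 * (sz x + 2) ^ c + (sz x + 2) ^ c * (2 * (sz x + 2) ^ c + 1) + 1" for x n
    proof -
      let ?n = "length (take n (l x))"
      have n: "?n \<le> (sz x + 2) ^ c" using le_trans [OF length_le_sz c [of x]] by simp
      then have "?n * (2 * ?n + 1) \<le> (sz x + 2) ^ c * (2 * (sz x + 2) ^ c + 1)"
        by (intro mult_mono) auto
      moreover have "sz ?n \<le> 2 * (sz x + 2) ^ c"
        using n sz_nat_le [of ?n] by linarith
      ultimately show ?thesis
        using sz_upt [of ?n] unfolding foldl_upt by simp
    qed
  qed (intro pt assms)+
  then have "poly_time (\<lambda>x. rev (snd (foldl (\<lambda>s _. (Suc (fst s), fst s # snd s)) (0, []) (l x))))"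
    by (intro pt)
  then show ?thesis by (simp add: foldl_upt)
qed


section \<open>The algorithm runs in polynomial time\<close>

text \<open>In a swap, the removed entry of \<open>u\<close> pays for the entry that puts
  \<open>u\<close> back with its new color.\<close>

lemma sz_filter_neq:
  "p \<in> set xs \<Longrightarrow> sz (filter (\<lambda>q. \<not> q = p) xs) + sz p + 1 \<le> sz xs"
proof (induction xs)
  case (Cons a xs)
  then show ?case using sz_filter_le [of "\<lambda>q. \<not> q = p" xs] by auto
qed simp

text \<open>A step adds at most one vertex and brings in at most one color taken from
  \<open>K\<close>. The growth is independent of the state, as the additive fold rule
  demands.\<close>

lemma sz_color_step:
  fixes s :: "('v::encodable, 'c::encodable) state"
  shows "sz (color_step adj K s v) \<le> sz s + (sz K + sz v + 5)"
proof -
  obtain B Bs where s: "s = (B, Bs)" by (cases s)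
  show ?thesis
  proof (cases "direct_colors adj K (B, Bs) v")
    case (Cons c cs)
    then have "c \<in> set (direct_colors adj K (B, Bs) v)" by simp
    then have "c \<in> set K" by (auto simp: direct_colors_def unused_def)
    then show ?thesis using Cons sz_member_le [of c K] by (simp add: color_step_def s)
  next
    case direct: Nil
    show ?thesis
    proof (cases "swaps adj K (B, Bs) v")
      case (Cons q qs)
      obtain c u d where q: "q = (c, (u, d))" by (cases q) auto
      have "q \<in> set (swaps adj K (B, Bs) v)" using Cons by simp
      then have "c \<in> set K" "(u, d) \<in> set B" by (auto simp: swaps_def unused_def q)
      then show ?thesis
        using direct Cons sz_member_le [of c K] sz_filter_neq [of "(u, d)" B]
        by (simp add: color_step_def s q)
    next
      case swaps: Nil
      show ?thesis
      proof (cases "filter (\<lambda>c. free_for adj (concat (B # Bs)) v c) K")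
        case Nil
        then show ?thesis using direct swaps by (simp add: color_step_def s)
      next
        case (Cons c cs)
        then have "c \<in> set (filter (\<lambda>c. free_for adj (concat (B # Bs)) v c) K)" by simp
        then have "c \<in> set K" by simp
        then show ?thesis
          using direct swaps Cons sz_member_le [of c K] by (simp add: color_step_def s)
      qed
    qed
  qed
qed

text \<open>The input lists each edge in some orientation, so both are looked up.\<close>

definition edge :: "(nat \<times> nat) list \<Rightarrow> nat \<Rightarrow> nat \<Rightarrow> bool" where
  "edge es u v \<longleftrightarrow> (u, v) \<in> set es \<or> (v, u) \<in> set es"

lemma poly_time_free_for [pt]:
  assumes "poly_time es" "poly_time F" "poly_time v" "poly_time (c :: _ \<Rightarrow> nat)"
  shows "poly_time (\<lambda>x. free_for (edge (es x)) (F x) (v x) (c x))"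
  unfolding free_for_def edge_def by (intro pt assms assms [THEN poly_time_comp])

lemma poly_time_unused [pt]:
  assumes "poly_time K" "poly_time (B :: _ \<Rightarrow> (nat \<times> nat) list)"
  shows "poly_time (\<lambda>x. unused (K x) (B x))"
  unfolding unused_def by (intro pt assms assms [THEN poly_time_comp])

lemma poly_time_direct_colors [pt]:
  assumes "poly_time es" "poly_time (K :: _ \<Rightarrow> nat list)" "poly_time s" "poly_time v"
  shows "poly_time (\<lambda>x. direct_colors (edge (es x)) (K x) (s x) (v x))"
  unfolding direct_colors_def by (intro pt assms assms [THEN poly_time_comp])

lemma poly_time_swaps [pt]:
  assumes "poly_time es" "poly_time (K :: _ \<Rightarrow> nat list)" "poly_time s" "poly_time v"
  shows "poly_time (\<lambda>x. swaps (edge (es x)) (K x) (s x) (v x))"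
  unfolding swaps_def by (intro pt assms assms [THEN poly_time_comp])

lemma poly_time_color_step [pt]:
  assumes "poly_time es" "poly_time (K :: _ \<Rightarrow> nat list)" "poly_time s" "poly_time v"
  shows "poly_time (\<lambda>x. color_step (edge (es x)) (K x) (s x) (v x))"
  unfolding color_step_def by (intro pt assms assms [THEN poly_time_comp])

lemma poly_time_color_vertices [pt]:
  assumes es: "poly_time (es :: 'a::encodable \<Rightarrow> _)" and K: "poly_time (K :: 'a \<Rightarrow> nat list)"
    and vs: "poly_time vs"
  shows "poly_time (\<lambda>x. color_vertices (edge (es x)) (K x) (vs x))"
proof -
  obtain c where c: "\<And>x. sz (K x) \<le> (sz x + 2) ^ c" using poly_time_bound [OF K] by blast
  show ?thesis
    unfolding color_vertices_def
  proof (rule poly_time_foldl_additive)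
    show "poly_time (\<lambda>p. color_step (edge (es (fst p))) (K (fst p)) (fst (snd p)) (snd (snd p)))"
      by (intro pt assms [THEN poly_time_comp])
    show "poly_bounded (\<lambda>n. (n + 2) ^ c + n + 5)" by (intro poly_bounded_intros)
    fix x :: 'a and v :: nat and s :: "(nat, nat) state"
    have "(sz x + 2) ^ c \<le> (sz x + sz v + 2) ^ c" by (rule power_mono) auto
    then show "sz (color_step (edge (es x)) (K x) s v) \<le> sz s + ((sz x + sz v + 2) ^ c + (sz x + sz v) + 5)"
      using sz_color_step [of "edge (es x)" "K x" s v] c [of x] by linarith
  qed (intro pt vs)+
qed

section \<open>Sorting by weight and the complete algorithm\<close>

definition frac_le :: "nat \<times> nat \<Rightarrow> nat \<times> nat \<Rightarrow> bool" where
  "frac_le p q \<longleftrightarrow> le_bits (mult_bits (bits (fst p)) (bits (snd q))) (mult_bits (bits (fst q)) (bits (snd p)))"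

lemma frac_le_iff: "frac_le p q \<longleftrightarrow> fst p * snd q \<le> fst q * snd p"
  by (simp add: frac_le_def le_bits_iff)

lemma poly_time_frac_le [pt]:
  "poly_time p \<Longrightarrow> poly_time q \<Longrightarrow> poly_time (\<lambda>x. frac_le (p x) (q x))"
  unfolding frac_le_def by (intro pt)

text \<open>One step of insertion sort: on a list with descending weights the two filters cut off a
  prefix and a suffix.\<close>

definition insert_desc :: "('k \<times> nat \<times> nat) list \<Rightarrow> 'k \<times> nat \<times> nat \<Rightarrow> ('k \<times> nat \<times> nat) list" where
  "insert_desc l p =
     filter (\<lambda>q. frac_le (snd p) (snd q)) l @ p # filter (\<lambda>q. \<not> frac_le (snd p) (snd q)) l"

definition by_weight :: "(nat \<times> nat) list \<Rightarrow> nat list" where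
  "by_weight ws = map fst (foldl insert_desc [] (zip [0..<length ws] ws))"

lemma poly_time_by_weight [pt]:
  assumes "poly_time ws"
  shows "poly_time (\<lambda>x. by_weight (ws x))"
proof -
  have "poly_time (\<lambda>x. foldl insert_desc [] (zip [0..<length (ws x)] (ws x)))"
  proof (rule poly_time_foldl_additive [where B = "\<lambda>n. n + 1"])
    show "poly_time (\<lambda>p. insert_desc (fst (snd p)) (snd (snd p)))"
      unfolding insert_desc_def by (intro pt)
    show "sz (insert_desc s a) \<le> sz s + (sz x + sz a + 1)"
      for x :: 'a and s :: "(nat \<times> nat \<times> nat) list" and a
    proof -
      have "sz (filter Q s) + sz (filter (\<lambda>q. \<not> Q q) s) = sz s" for Q
        by (induction s) auto
      from this [of "\<lambda>q. frac_le (snd a) (snd q)"] show ?thesis by (simp add: insert_desc_def)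
    qed
  qed (intro pt assms poly_bounded_intros)+
  then show ?thesis unfolding by_weight_def by (intro pt)
qed

text \<open>\<open>k\<close> is given in binary, so listing \<open>{1..k}\<close> could take
  exponential time. Cutting at one color per vertex keeps the palette short.\<close>

definition palette :: "nat \<Rightarrow> nat \<Rightarrow> nat list" where
  "palette n k = filter (\<lambda>i. i \<le> k) (map Suc [0..<n])"

text \<open>The default 0 is no color; for the final assignment every vertex has an entry.\<close>

definition lookup_color :: "(nat \<times> nat) list \<Rightarrow> nat \<Rightarrow> nat" where
  "lookup_color A v = (case filter (\<lambda>p. fst p = v) A of [] \<Rightarrow> 0 | p # _ \<Rightarrow> snd p)"

definition final_state :: "(nat \<times> nat) list \<times> (nat \<times> nat) list \<times> nat \<Rightarrow> (nat, nat) state" where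
  "final_state x = color_vertices (edge (fst (snd x)))
     (palette (length (fst x)) (snd (snd x))) (by_weight (fst x))"

definition color_instance :: "(nat \<times> nat) list \<times> (nat \<times> nat) list \<times> nat \<Rightarrow> nat list" where
  "color_instance x =
     map (lookup_color (concat (fst (final_state x) # snd (final_state x)))) [0..<length (fst x)]"

lemma poly_time_palette [pt]:
  assumes "poly_time l" "poly_time k"
  shows "poly_time (\<lambda>x. palette (length (l x)) (k x))"
  unfolding palette_def by (intro pt assms assms [THEN poly_time_comp])

lemma poly_time_lookup_color [pt]:
  assumes "poly_time A" "poly_time v"
  shows "poly_time (\<lambda>x. lookup_color (A x) (v x))"
  unfolding lookup_color_def by (intro pt assms assms [THEN poly_time_comp])

lemma poly_time_color_instance: "poly_time color_instance"
  unfolding color_instance_def [abs_def] final_state_def by (intro pt)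

text \<open>Runs start at function 0, so an entry function is put in front and the program is
  relocated by one. \<open>h\<close> reads an admissible input as a value with the same
  encoding.\<close>

lemma poly_time_solvableI:
  assumes f: "poly_time f"
    and sol: "\<And>x. x \<in> I \<Longrightarrow> R x (f (h x))"
    and enc_in: "\<And>x. x \<in> I \<Longrightarrow> enc_in x = encode (h x)"
    and enc_out: "\<And>y. enc_out y = encode y"
  shows "poly_time_solvable enc_in enc_out I R"
proof -
  obtain P i c where P: "callable P i f c" using f unfolding poly_time_def by blast
  let ?P = "Call (Suc i) [Var 0] # map (shift_calls 1) P"
  have P': "callable ?P (Suc i) f c"
    using callable_link [OF P, of "[Call (Suc i) [Var 0]]" "[]"] by (simp add: One_nat_def)
  have "poly_bounded (\<lambda>n. (1 + 1 + 1) + (1 + (n + 2) ^ c + 3) + 1 + (n + 2) ^ c)"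
    by (intro poly_bounded_intros)
  from poly_bounded_monomial [OF this] obtain d where d: "\<And>n. (1 + 1 + 1) + (1 + (n + 2) ^ c + 3) + 1 + (n + 2) ^ c \<le> d * n ^ d + d"
    by blast
  show ?thesis
    unfolding poly_time_solvable_def
  proof (rule exI, rule exI, rule ballI)
    fix x assume x: "x \<in> I"
    have "run ?P [encode (h x)] (Call 0 [Var 0]) (encode (f (h x)))
        ((1 + 1 + 1) + (1 + (sz (h x) + 2) ^ c + 3) + 1)"
    proof (rule run_Call)
      show "run_list ?P [encode (h x)] [Var 0] [encode (h x)] (1 + 1 + 1)"
        by (intro run_Cons run_Nil run_Var) simp_all
      show "run ?P [encode (h x)] (?P ! 0) (encode (f (h x))) (1 + (sz (h x) + 2) ^ c + 3)"
        unfolding nth_Cons_0 by (intro run_call1 [OF P'] run_Var) simp_all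
    qed simp
    then obtain t where t: "t \<le> (1 + 1 + 1) + (1 + (sz (h x) + 2) ^ c + 3) + 1"
      "computes ?P [encode (h x)] (Call 0 [Var 0]) (encode (f (h x))) t"
      unfolding run_def by blast
    then have "runs ?P (enc_in x) (enc_out (f (h x))) t"
      by (simp add: runs_def enc_in x enc_out)
    moreover have "t + size (enc_out (f (h x))) \<le> d * size (enc_in x) ^ d + d"
      using t(1) d [of "sz (h x)"] callable_size [OF P, of "h x"] by (simp add: enc_in x enc_out)
    ultimately show "\<exists>y t. R x y \<and> runs ?P (enc_in x) (enc_out y) t \<and>
        t + size (enc_out y) \<le> d * size (enc_in x) ^ d + d"
      using sol [OF x] by blast
  qed
qed


section \<open>Fair colorings of weighted graphs\<close>

text \<open>Sending a neighbor \<open>u\<close> of \<open>v\<close> to the edge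
  \<open>{u, v}\<close> is injective, which bounds the number of neighbors by
  \<open>vdegree E v\<close>.\<close>

lemma weighted_graph_adj:
  assumes "weighted_graph V E w"
  shows "finite V" "{v, v} \<notin> E" "\<And>v. v \<in> V \<Longrightarrow> card {u \<in> V. {u, v} \<in> E} \<le> max_degree V E"
proof -
  show V: "finite V" using assms by (simp add: weighted_graph_def)
  have E: "\<And>e. e \<in> E \<Longrightarrow> \<exists>u\<in>V. \<exists>v\<in>V. u \<noteq> v \<and> e = {u, v}"
    using assms by (simp add: weighted_graph_def)
  show "{v, v} \<notin> E" using E [of "{v, v}"] by (auto simp: doubleton_eq_iff)
  fix v assume v: "v \<in> V"
  have "E \<subseteq> Pow V" using E by force
  then have fin: "finite E" using V finite_subset by auto
  have "card {u \<in> V. {u, v} \<in> E} = card ((\<lambda>u. {u, v}) ` {u \<in> V. {u, v} \<in> E})"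
    by (rule card_image [symmetric]) (auto simp: inj_on_def doubleton_eq_iff)
  also have "\<dots> \<le> vdegree E v"
    unfolding vdegree_def using fin by (intro card_mono) auto
  also have "\<dots> \<le> max_degree V E"
    unfolding max_degree_def using v V by (intro Max_ge) auto
  finally show "card {u \<in> V. {u, v} \<in> E} \<le> max_degree V E" .
qed

text \<open>The logarithm is nonnegative and \<open>1 + \<epsilon>\<close> is at least 1, so the
  factor in front of \<open>\<Delta>\<close> is at least 16 divided by the square of
  \<open>\<epsilon>\<close>. With \<open>\<epsilon> \<le> 1\<close> this gives
  \<open>16 * \<Delta> \<le> \<epsilon> * k\<close>, hence \<open>(1 + 3 * \<epsilon>) * \<Delta>
  \<le> 2 * \<Delta> \<le> 3 * \<epsilon> * k\<close>, which rearranges to the second claim.\<close>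

lemma enough_colors:
  fixes \<epsilon> :: real and \<Delta> k :: nat
  assumes "0 < \<epsilon>" "\<epsilon> \<le> 1 / 10" "0 < k"
    and "4 * (1 + \<epsilon>)\<^sup>2 / \<epsilon>\<^sup>2 * (ln (1 / \<epsilon>) + 4) * real \<Delta> \<le> real k"
  shows "\<Delta> < k" "real k \<le> (1 + 3 * \<epsilon>) * real (k - \<Delta>)"
proof -
  have ln: "0 \<le> ln (1 / \<epsilon>)" using assms(1,2) by simp
  have "16 / \<epsilon>\<^sup>2 = 4 * 1 / \<epsilon>\<^sup>2 * 4" by simp
  also have "\<dots> \<le> 4 * (1 + \<epsilon>)\<^sup>2 / \<epsilon>\<^sup>2 * (ln (1 / \<epsilon>) + 4)"
    using ln assms(1) by (intro mult_mono divide_right_mono) auto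
  finally have "16 / \<epsilon>\<^sup>2 * \<Delta> \<le> 4 * (1 + \<epsilon>)\<^sup>2 / \<epsilon>\<^sup>2 * (ln (1 / \<epsilon>) + 4) * \<Delta>"
    by (rule mult_right_mono) simp
  then have "16 / \<epsilon>\<^sup>2 * \<Delta> \<le> k" using assms(4) by simp
  then have "16 * \<Delta> \<le> \<epsilon>\<^sup>2 * k" using assms(1) by (simp add: field_simps)
  also have "\<dots> \<le> \<epsilon> * k" 
    using assms(1,2) by (intro mult_right_mono) (simp_all add: power2_eq_square mult_left_le)
  finally have *: "16 * \<Delta> \<le> \<epsilon> * k" .
  also have "\<dots> < 16 * k" using assms by simp
  finally show less: "\<Delta> < k" by simp
  have "(1 + 3 * \<epsilon>) * \<Delta> \<le> 2 * real \<Delta>" using assms(2) by (intro mult_right_mono) auto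
  also have "\<dots> \<le> 3 * \<epsilon> * k" using * by linarith
  finally show "real k \<le> (1 + 3 * \<epsilon>) * real (k - \<Delta>)"
    using less by (simp add: of_nat_diff algebra_simps)
qed

text \<open>Joins two regimes. With at least as many colors as vertices all classes are at most
  singletons; otherwise the palette is all of \<open>{1..k}\<close> and the block analysis applies
  with \<open>\<alpha> = 1 + 3 * \<epsilon>\<close>.\<close>

lemma color_vertices_fair:
  fixes \<epsilon> :: real and K :: "nat list"
  assumes G: "weighted_graph V E w" and \<epsilon>: "0 < \<epsilon>" "\<epsilon> \<le> 1 / 10" "0 < k"
    "4 * (1 + \<epsilon>)\<^sup>2 / \<epsilon>\<^sup>2 * (ln (1 / \<epsilon>) + 4) * real (max_degree V E) \<le> real k"
    and vs: "distinct vs" "set vs = V" "sorted_wrt (\<lambda>u v. w v \<le> w u) vs"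
    and K: "distinct K" "set K \<subseteq> {1..k}" "set K = {1..k} \<or> length vs \<le> length K"
    and s: "color_vertices (\<lambda>u v. {u, v} \<in> E) K vs = (B, Bs)"
  shows "distinct (map fst (concat (B # Bs))) \<and> fst ` set (concat (B # Bs)) = V \<and>
    snd ` set (concat (B # Bs)) \<subseteq> set K \<and>
    is_coloring V E k (color_class (B # Bs)) \<and> EQ1 (1 + 3 * \<epsilon>) w k (color_class (B # Bs))"
proof -
  let ?C = "color_class (B # Bs)" and ?w = "\<lambda>v. real_of_rat (w v)"
  have *: "distinct (map fst (concat (B # Bs))) \<and> fst ` set (concat (B # Bs)) = V \<and>
    snd ` set (concat (B # Bs)) \<subseteq> set K \<and>
    (\<forall>c u v. u \<in> ?C c \<longrightarrow> v \<in> ?C c \<longrightarrow> {u, v} \<notin> E) \<and>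
    (\<forall>i j. ?C i \<noteq> {} \<longrightarrow> j \<in> {1..k} \<longrightarrow>
      (\<exists>v\<in>?C i. sum ?w (?C i - {v}) \<le> (1 + 3 * \<epsilon>) * sum ?w (?C j)))"
  proof (cases "length vs \<le> length K")
    case True
    obtain B' where B': "color_vertices (\<lambda>u v. {u, v} \<in> E) K vs = (B', [])"
      "map fst B' = rev vs" "distinct (map snd B')" "snd ` set B' \<subseteq> set K"
      using color_vertices_few [OF K(1) True] by blast
    then have eq: "B = B'" "Bs = []" using s by auto
    have fst: "fst ` set B = V" using arg_cong [OF B'(2), of set] vs(2) eq by simp
    have single: "u = v" if "u \<in> ?C c" "v \<in> ?C c" for u v c
      using that distinct_snd_unique [OF B'(3)] by (simp add: eq)
    have proper: "{u, v} \<notin> E" if "u \<in> ?C c" "v \<in> ?C c" for u v c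
      using single [OF that] weighted_graph_adj(2) [OF G, of v] by simp
    have "sum ?w (?C i - {v}) \<le> (1 + 3 * \<epsilon>) * sum ?w (?C j)" if "v \<in> ?C i" for i j v
    proof -
      \<comment> \<open>Nothing remains after the removal, so the comparison holds even with the
        empty class of a color outside \<open>K\<close>.\<close>
      have empty: "?C i - {v} = {}" using single that by blast
      have "0 \<le> sum ?w (?C j)"
      proof (rule sum_nonneg)
        fix x assume "x \<in> ?C j"
        then have "x \<in> V" using fst by (force simp: eq)
        then show "0 \<le> ?w x" using G by (simp add: weighted_graph_def)
      qed
      then show ?thesis unfolding empty using \<epsilon>(1) by simp
    qed
    moreover have "distinct (map fst (concat (B # Bs)))" "fst ` set (concat (B # Bs)) = V"
      "snd ` set (concat (B # Bs)) \<subseteq> set K"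
      using B' vs(1) fst by (auto simp: eq)
    ultimately show ?thesis using proper by blast
  next
    case False
    then have setK: "set K = {1..k}" using K(3) by simp
    then have lenK: "length K = k" using distinct_card [OF K(1)] by simp
    note en = enough_colors [OF \<epsilon>]
    interpret colored_graph V "\<lambda>u v. {u, v} \<in> E" ?w "max_degree V E" K
    proof
      show "{v, u} \<in> E" if "{u, v} \<in> E" for u v using that by (simp add: insert_commute)
      show "0 \<le> ?w v" if "v \<in> V" for v using that G by (simp add: weighted_graph_def)
    qed (use weighted_graph_adj [OF G] K(1) en(1) lenK in auto)
    have sorted: "sorted_wrt (\<lambda>u v. ?w v \<le> ?w u) vs" using vs(3) by (simp add: of_rat_less_eq)
    have \<alpha>: "0 \<le> 1 + 3 * \<epsilon>" "real (length K) \<le> (1 + 3 * \<epsilon>) * real (length K - max_degree V E)"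
      using \<epsilon>(1) en(2) lenK by simp_all
    note correct = color_vertices_correct [OF vs(1) eq_refl [OF vs(2)] sorted \<alpha> s]
    show ?thesis
    proof (intro conjI allI impI)
      show "distinct (map fst (concat (B # Bs)))" by (rule correct(1))
      show "fst ` set (concat (B # Bs)) = V" unfolding correct(2) by (rule vs(2))
      show "snd ` set (concat (B # Bs)) \<subseteq> set K" by (rule correct(3))
      show "{u, v} \<notin> E" if "u \<in> ?C c" "v \<in> ?C c" for c u v using that by (rule correct(4))
      show "\<exists>v\<in>?C i. sum ?w (?C i - {v}) \<le> (1 + 3 * \<epsilon>) * sum ?w (?C j)"
        if "?C i \<noteq> {}" "j \<in> {1..k}" for i j
        using that unfolding setK [symmetric] by (rule correct(5))
    qed
  qed
  note dist = * [THEN conjunct1] and verts = * [THEN conjunct2, THEN conjunct1]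
    and cols = * [THEN conjunct2, THEN conjunct2, THEN conjunct1]
    and proper = * [THEN conjunct2, THEN conjunct2, THEN conjunct2, THEN conjunct1]
    and balanced = * [THEN conjunct2, THEN conjunct2, THEN conjunct2, THEN conjunct2]
  have sub: "?C c \<subseteq> V" for c
  proof
    fix v assume "v \<in> ?C c"
    then have "fst (v, c) \<in> fst ` set (concat (B # Bs))"
      unfolding color_class_def by (intro imageI) (rule CollectD)
    then show "v \<in> V" unfolding verts fst_conv .
  qed
  have "is_coloring V E k ?C"
    unfolding is_coloring_def independent_set_def
  proof (intro conjI ballI impI)
    have "v \<in> (\<Union>i\<in>{1..k}. ?C i)" if v: "v \<in> V" for v
    proof -
      obtain p where p: "p \<in> set (concat (B # Bs))" "fst p = v"
        using v unfolding verts [symmetric] by blast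
      then have "snd p \<in> {1..k}" using cols K(2) by blast
      moreover have "v \<in> ?C (snd p)" using p unfolding color_class_def by (metis mem_Collect_eq prod.collapse)
      ultimately show ?thesis by blast
    qed
    then show "(\<Union>i\<in>{1..k}. ?C i) = V" using sub by blast
    show "?C i \<inter> ?C j = {}" if "i \<noteq> j" for i j
    proof -
      have "inj_on fst (set (concat (B # Bs)))" using dist by (simp only: distinct_map)
      then have "False" if "(v, i) \<in> set (concat (B # Bs))" "(v, j) \<in> set (concat (B # Bs))" for v
        using inj_onD [of fst _ "(v, i)" "(v, j)"] that \<open>i \<noteq> j\<close> by (metis fst_conv snd_conv)
      then show ?thesis unfolding color_class_def by blast
    qed
  qed (use proper in blast)
  moreover have "EQ1 (1 + 3 * \<epsilon>) w k ?C"
    unfolding EQ1_def of_rat_sum using balanced by blast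
  ultimately show ?thesis using dist verts cols by blast
qed


section \<open>Correctness on encoded instances\<close>

text \<open>Stands for the rational inside the programs, which handle pairs of naturals; the
  encoding is the same.\<close>

definition to_frac :: "rat \<Rightarrow> nat \<times> nat" where
  "to_frac q = (nat (fst (quotient_of q)), nat (snd (quotient_of q)))"

definition frac_inst :: "inst \<Rightarrow> (nat \<times> nat) list \<times> (nat \<times> nat) list \<times> nat" where
  "frac_inst x = (map to_frac (fst x), snd x)"

lemma encode_frac: "encode (to_frac q) = enc_rat q"
  by (simp add: to_frac_def enc_rat_def enc_pair_def encode_nat_def)

lemma encode_frac_inst: "encode (frac_inst x) = enc_inst x"
proof -
  have "encode (map to_frac ws) = enc_list enc_rat ws" for ws
    by (induction ws) (simp_all add: enc_list_def encode_frac)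
  moreover have "encode (es :: (nat \<times> nat) list) = enc_list (enc_pair enc_nat enc_nat) es" for es
    by (induction es) (auto simp: enc_list_def enc_pair_def encode_nat_def)
  ultimately show ?thesis
    by (cases x) (simp add: frac_inst_def enc_inst_def enc_pair_def encode_nat_def)
qed

text \<open>Cross multiplication is valid since denominators are positive, and nonnegative
  numerators pass through \<open>nat\<close> unchanged.\<close>

lemma frac_le_frac:
  assumes "0 \<le> a" "0 \<le> b"
  shows "frac_le (to_frac a) (to_frac b) \<longleftrightarrow> a \<le> b"
proof -
  obtain n d where a: "quotient_of a = (n, d)" by (cases "quotient_of a")
  obtain m e where b: "quotient_of b = (m, e)" by (cases "quotient_of b")
  have d: "0 < d" "0 < e" using quotient_of_denom_pos a b by blast+
  have eq: "a = of_int n / of_int d" "b = of_int m / of_int e"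
    using quotient_of_div a b by blast+
  have n: "0 \<le> n" "0 \<le> m" using assms d by (auto simp: eq zero_le_divide_iff)
  have "a \<le> b \<longleftrightarrow> (of_int n * of_int e :: rat) \<le> of_int m * of_int d"
    using d by (simp add: eq field_simps)
  also have "\<dots> \<longleftrightarrow> n * e \<le> m * d"
    by (metis of_int_le_iff of_int_mult)
  also have "\<dots> \<longleftrightarrow> nat n * nat e \<le> nat m * nat d"
    using d n by (simp add: nat_mult_distrib [symmetric] nat_le_eq_zle)
  finally show ?thesis by (simp add: frac_le_iff to_frac_def a b)
qed

lemma by_weight_correct:
  fixes ws :: "rat list"
  assumes "\<And>v. v < length ws \<Longrightarrow> 0 \<le> ws ! v"
  shows "distinct (by_weight (map to_frac ws))" "set (by_weight (map to_frac ws)) = {..<length ws}"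
    "sorted_wrt (\<lambda>u v. ws ! v \<le> ws ! u) (by_weight (map to_frac ws))"
proof -
  let ?ok = "\<lambda>p. fst p < length ws \<and> snd p = to_frac (ws ! fst p)"
  let ?Z = "zip [0..<length ws] (map to_frac ws)"
  have fold: "distinct (map fst (foldl insert_desc [] ps)) \<and>
      set (foldl insert_desc [] ps) = set ps \<and>
      sorted_wrt (\<lambda>u v. ws ! v \<le> ws ! u) (map fst (foldl insert_desc [] ps))"
    if "distinct (map fst ps)" "\<forall>p\<in>set ps. ?ok p" for ps
    using that
  proof (induction ps rule: rev_induct)
    case (snoc p ps)
    let ?l = "foldl insert_desc [] ps"
    let ?Q = "\<lambda>q. frac_le (snd p) (snd q)"
    have IH: "distinct (map fst ?l)" "set ?l = set ps"
      "sorted_wrt (\<lambda>u v. ws ! v \<le> ws ! u) (map fst ?l)"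
      using snoc by auto
    have Q: "?Q q \<longleftrightarrow> ws ! fst p \<le> ws ! fst q" if "q \<in> set ?l" for q
    proof -
      have "?ok p" "?ok q" using snoc.prems(2) that IH(2) by auto
      then show ?thesis using frac_le_frac assms by auto
    qed
    \<comment> \<open>Entries kept by the first filter weigh at least as much as \<open>p\<close>,
      the others less, and each part inherits the order of the list.\<close>
    have "sorted_wrt (\<lambda>q r. ws ! fst r \<le> ws ! fst q) (insert_desc ?l p)"
      using IH(3) Q
      by (auto simp: insert_desc_def sorted_wrt_append sorted_wrt_map intro: sorted_wrt_filter)
    moreover have "distinct (map fst (insert_desc ?l p))"
      using IH(1,2) snoc.prems(1)
      by (auto simp: insert_desc_def distinct_map intro: inj_on_subset dest: inj_onD)
    moreover have "set (insert_desc ?l p) = set (ps @ [p])"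
      using IH(2) by (auto simp: insert_desc_def)
    ultimately show ?case by (simp add: sorted_wrt_map)
  qed simp
  have fst_Z: "map fst ?Z = [0..<length ws]" by simp
  then have "distinct (map fst ?Z)" by simp
  moreover have "\<forall>p\<in>set ?Z. ?ok p" by (auto simp: set_zip)
  ultimately have l: "distinct (map fst (foldl insert_desc [] ?Z))"
    "set (foldl insert_desc [] ?Z) = set ?Z"
    "sorted_wrt (\<lambda>u v. ws ! v \<le> ws ! u) (map fst (foldl insert_desc [] ?Z))"
    using fold [of ?Z] by blast+
  then show "distinct (by_weight (map to_frac ws))"
    "sorted_wrt (\<lambda>u v. ws ! v \<le> ws ! u) (by_weight (map to_frac ws))"
    by (simp_all add: by_weight_def)
  have "set (by_weight (map to_frac ws)) = fst ` set ?Z"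
    using l(2) by (simp add: by_weight_def)
  also have "\<dots> = set [0..<length ws]"
    using arg_cong [OF fst_Z, of set] by (simp only: set_map)
  also have "\<dots> = {..<length ws}" by (simp add: atLeast0LessThan)
  finally show "set (by_weight (map to_frac ws)) = {..<length ws}" .
qed

lemma palette_correct:
  "distinct (palette n k)" "set (palette n k) \<subseteq> {1..k}"
  "set (palette n k) = {1..k} \<or> n \<le> length (palette n k)"
proof -
  show "distinct (palette n k)" by (simp add: palette_def distinct_map)
  have set: "set (palette n k) = {1..n} \<inter> {..k}"
    by (auto simp: palette_def image_iff Suc_le_eq)
  then show "set (palette n k) \<subseteq> {1..k}" by auto
  show "set (palette n k) = {1..k} \<or> n \<le> length (palette n k)"
  proof (cases "n \<le> k")
    case True
    then have "filter (\<lambda>i. i \<le> k) (map Suc [0..<n]) = map Suc [0..<n]"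
      by (intro filter_True) auto
    then show ?thesis by (simp add: palette_def)
  next
    case False
    then show ?thesis using set by auto
  qed
qed

lemma lookup_color_eq:
  assumes "distinct (map fst A)" "(v, c) \<in> set A"
  shows "lookup_color A v = c"
proof -
  have "(v, c) \<in> set (filter (\<lambda>p. fst p = v) A)" using assms(2) by simp
  then obtain p ps where p: "filter (\<lambda>p. fst p = v) A = p # ps"
    by (cases "filter (\<lambda>p. fst p = v) A") auto
  then have "p \<in> set (filter (\<lambda>p. fst p = v) A)" by simp
  then have "p \<in> set A" "fst p = v" by auto
  then have "p = (v, c)"
    using assms inj_onD [of fst "set A" p "(v, c)"] by (auto simp: distinct_map)
  then show ?thesis using p by (simp add: lookup_color_def)
qed

text \<open>Looking up the color of each vertex in the final assignment reproduces its color
  classes, so fairness carries over to the output list.\<close>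

lemma color_instance_solves:
  assumes "admissible_inst x \<epsilon>"
  shows "solves_inst x \<epsilon> (color_instance (frac_inst x))"
proof -
  obtain ws es k where x: "x = (ws, es, k)" by (cases x) auto
  let ?n = "length ws" and ?E = "inst_E x" and ?V = "inst_V x" and ?w = "inst_w x"
  let ?K = "palette ?n k" and ?vs = "by_weight (map to_frac ws)"
  have V: "?V = {..<?n}" and k: "inst_k x = k" and w: "?w = (\<lambda>v. ws ! v)"
    by (simp_all add: x inst_V_def inst_k_def inst_w_def)
  note adm = assms [unfolded admissible_inst_def k]
  have G: "weighted_graph ?V ?E ?w" using adm by blast
  have "0 \<le> ws ! v" if "v < ?n" for v
    using G that by (simp add: weighted_graph_def V w)
  then have vs: "distinct ?vs" "set ?vs = {..<?n}" "sorted_wrt (\<lambda>u v. ws ! v \<le> ws ! u) ?vs"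
    using by_weight_correct by blast+
  have "edge es = (\<lambda>u v. {u, v} \<in> ?E)"
    by (intro ext) (auto simp: edge_def x inst_E_def doubleton_eq_iff)
  moreover obtain B Bs where s: "color_vertices (edge es) ?K ?vs = (B, Bs)"
    by (cases "color_vertices (edge es) ?K ?vs")
  ultimately have s': "color_vertices (\<lambda>u v. {u, v} \<in> ?E) ?K ?vs = (B, Bs)" by simp
  have len: "length ?vs = ?n"
    using distinct_card [OF vs(1)] vs(2) by simp
  have fair: "distinct (map fst (concat (B # Bs))) \<and> fst ` set (concat (B # Bs)) = ?V \<and>
    snd ` set (concat (B # Bs)) \<subseteq> set ?K \<and>
    is_coloring ?V ?E k (color_class (B # Bs)) \<and> EQ1 (1 + 3 * \<epsilon>) ?w k (color_class (B # Bs))"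
    using color_vertices_fair [OF G _ _ _ _ _ _ _ _ _ _ s'] adm vs palette_correct [of ?n k]
    unfolding V w len by blast
  let ?A = "concat (B # Bs)" and ?cs = "color_instance (frac_inst x)"
  have cs: "?cs = map (lookup_color ?A) [0..<?n]"
    by (simp add: color_instance_def final_state_def frac_inst_def x s)
  have look: "(v, lookup_color ?A v) \<in> set ?A" if "v < ?n" for v
  proof -
    have "v \<in> fst ` set ?A" using fair that V by auto
    then obtain c where "(v, c) \<in> set ?A" by (metis imageE prod.collapse)
    moreover from this have "lookup_color ?A v = c" using lookup_color_eq fair by blast
    ultimately show ?thesis by simp
  qed
  have "classes ?cs i = color_class (B # Bs) i" for i
  proof (intro set_eqI iffI)
    fix v assume "v \<in> classes ?cs i"
    then have "v < ?n" "lookup_color ?A v = i" by (auto simp: classes_def cs)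
    then show "v \<in> color_class (B # Bs) i" using look [of v] unfolding color_class_def by blast
  next
    fix v assume "v \<in> color_class (B # Bs) i"
    then have vi: "(v, i) \<in> set ?A" unfolding color_class_def by blast
    then have "v \<in> fst ` set ?A" by (force simp only: fst_conv)
    then have "v < ?n" using fair V by auto
    moreover have "lookup_color ?A v = i" using lookup_color_eq fair vi by blast
    ultimately show "v \<in> classes ?cs i" by (simp add: classes_def cs)
  qed
  then have "classes ?cs = color_class (B # Bs)" by blast
  moreover have "c \<in> {1..k}" if "c \<in> set ?cs" for c
  proof -
    obtain v where "v < ?n" "c = lookup_color ?A v" using \<open>c \<in> set ?cs\<close> by (auto simp: cs)
    then have "c \<in> snd ` set ?A" using look [of v] by force
    then show ?thesis using fair palette_correct(2) [of ?n k] by blast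
  qed
  ultimately show ?thesis
    using fair unfolding solves_inst_def k by (simp add: V cs)
qed

text \<open>The second conjunct fixes a real \<open>\<epsilon>\<close> outside the input; the third
  supplies a rational one as part of the input, so that one program works for all of them. As the
  algorithm never consults \<open>\<epsilon>\<close>, the latter follows by projecting to the
  instance.\<close>

theorem theorem4:
  shows "(\<forall>(V :: 'v set) E (w :: 'v \<Rightarrow> rat) (\<epsilon> :: real) (k :: nat).
            weighted_graph V E w \<and> 0 < \<epsilon> \<and> \<epsilon> \<le> 1 / 10 \<and> 0 < k \<and>
            4 * (1 + \<epsilon>)\<^sup>2 / \<epsilon>\<^sup>2 * (ln (1 / \<epsilon>) + 4) * real (max_degree V E) \<le> real k \<longrightarrow>
            (\<exists>C. is_coloring V E k C \<and> EQ1 (1 + 3 * \<epsilon>) w k C))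
       \<and> (\<forall>\<epsilon> :: real.
            poly_time_solvable enc_inst (enc_list enc_nat)
              {x. admissible_inst x \<epsilon>}
              (\<lambda>x cs. solves_inst x \<epsilon> cs))
       \<and> poly_time_solvable (enc_pair enc_inst enc_rat) (enc_list enc_nat)
            {(x, q). admissible_inst x (real_of_rat q)}
            (\<lambda>(x, q) cs. solves_inst x (real_of_rat q) cs)"
proof (intro conjI allI impI)
  fix V :: "'v set" and E and w :: "'v \<Rightarrow> rat" and \<epsilon> :: real and k :: nat
  assume a: "weighted_graph V E w \<and> 0 < \<epsilon> \<and> \<epsilon> \<le> 1 / 10 \<and> 0 < k \<and>
    4 * (1 + \<epsilon>)\<^sup>2 / \<epsilon>\<^sup>2 * (ln (1 / \<epsilon>) + 4) * real (max_degree V E) \<le> real k"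
  then have "finite V" by (simp add: weighted_graph_def)
  then obtain xs where xs: "set xs = V" "distinct xs" using finite_distinct_list by blast
  \<comment> \<open>Negating the weights turns the ascending sort into the required descending
    order.\<close>
  let ?vs = "sort_key (\<lambda>v. - w v) xs"
  have "sorted (map (\<lambda>v. - w v) ?vs)" by (rule sorted_sort_key)
  then have "sorted_wrt (\<lambda>u v. w v \<le> w u) ?vs" by (simp add: sorted_wrt_map)
  \<comment> \<open>Mere existence puts no limit on the length of the palette, so all of
    \<open>{1..k}\<close> is listed.\<close>
  moreover obtain B Bs where "color_vertices (\<lambda>u v. {u, v} \<in> E) [1..<Suc k] ?vs = (B, Bs)"
    by (cases "color_vertices (\<lambda>u v. {u, v} \<in> E) [1..<Suc k] ?vs")
  ultimately have "is_coloring V E k (color_class (B # Bs)) \<and>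
      EQ1 (1 + 3 * \<epsilon>) w k (color_class (B # Bs))"
    using color_vertices_fair [of V E w \<epsilon> k ?vs "[1..<Suc k]" B Bs] a xs
    by (simp add: atLeastLessThanSuc_atLeastAtMost del: upt_Suc)
  then show "\<exists>C. is_coloring V E k C \<and> EQ1 (1 + 3 * \<epsilon>) w k C" by blast
next
  have enc_out: "enc_list enc_nat cs = encode cs" for cs
    by (induction cs) (simp_all add: enc_list_def encode_nat_def)
  show "poly_time_solvable enc_inst (enc_list enc_nat) {x. admissible_inst x \<epsilon>}
      (\<lambda>x cs. solves_inst x \<epsilon> cs)" for \<epsilon>
    by (rule poly_time_solvableI [where f = color_instance and h = frac_inst])
      (simp_all add: poly_time_color_instance color_instance_solves encode_frac_inst enc_out)
  show "poly_time_solvable (enc_pair enc_inst enc_rat) (enc_list enc_nat)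
      {(x, q). admissible_inst x (real_of_rat q)}
      (\<lambda>(x, q) cs. solves_inst x (real_of_rat q) cs)"
  proof (rule poly_time_solvableI [where f = "\<lambda>p. color_instance (fst p)"
        and h = "\<lambda>(x, q). (frac_inst x, to_frac q)"])
    show "poly_time (\<lambda>p :: _ \<times> nat \<times> nat. color_instance (fst p))"
      by (intro poly_time_comp [OF poly_time_color_instance] pt)
  qed (auto simp: color_instance_solves encode_frac_inst encode_frac enc_pair_def enc_out)
qed

end
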